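(* Let $R$ be a commutative ring and $\mathfrak a\subseteq R$ an ideal. a) Let $S\subseteq R$ be a subset. If $\rho^S_{\mathfrak a}$ is an isomorphism and $\mathfrak a$ is weakly fair, then $S^{-1}\mathfrak a$ is weakly fair (as an ideal of $S^{-1}R$). If $\overline\rho^S_{\mathfrak a}$ is an isomorphism and $\mathfrak a$ is weakly large fair, then $S^{-1}\mathfrak a$ is weakly large fair. b) If $\rho^{\mathfrak m}_{\mathfrak a}$ is an isomorphism for every maximal ideal $\mathfrak m$ of $R$, then $\mathfrak a$ is weakly fair if and only if $\mathfrak a_{\mathfrak m}$ is weakly fair (as an ideal of $R_{\mathfrak m}$) for every maximal ideal $\mathfrak m$ of $R$. If $\overline\rho^{\mathfrak m}_{\mathfrak a}$ is an isomorphism for every maximal ideal $\mathfrak m$ of $R$, then $\mathfrak a$ is weakly large fair if and only if $\mathfrak a_{\mathfrak m}$ is weakly large fair for every maximal ideal $\mathfrak m$ of $R$.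
   Context: Rings are commutative with unit (possibly zero). For a ring $R$, an ideal $\mathfrak a\subseteq R$ and an $R$-module $M$: $\operatorname{Var}(\mathfrak a)=\{\mathfrak p\in\operatorname{Spec}(R)\mid\mathfrak a\subseteq\mathfrak p\}$; $\Gamma_{\mathfrak a}(M)=\{x\in M\mid\exists n\in\mathbb N:\mathfrak a^n\subseteq(0:_Rx)\}$; $\overline\Gamma_{\mathfrak a}(M)=\{x\in M\mid\mathfrak a\subseteq\sqrt{(0:_Rx)}\}$; $\operatorname{Ass}^{\mathrm f}_R(M)=\{\mathfrak p\in\operatorname{Spec}(R)\mid\exists x\in M:\mathfrak p\in\min(0:_Rx)\}$ (weak assassin), where $\min(\mathfrak b)$ is the set of minimal elements of $\operatorname{Var}(\mathfrak b)$. For a subset $S\subseteq R$, $S^{-1}$ denotes localisation at the multiplicative set generated by $S$; a subscript $\mathfrak m$ denotes localisation at $S=R\setminus\mathfrak m$. For every $R$-module $M$, the inclusions $\Gamma_{\mathfrak a}(M)\subseteq M$ and $\overline\Gamma_{\mathfrak a}(M)\subseteq M$ induce canonical monomorphisms of functors (in $M$) $\rho^S_{\mathfrak a}\colon S^{-1}\Gamma_{\mathfrak a}(M)\to\Gamma_{S^{-1}\mathfrak a}(S^{-1}M)$ and $\overline\rho^S_{\mathfrak a}\colon S^{-1}\overline\Gamma_{\mathfrak a}(M)\to\overline\Gamma_{S^{-1}\mathfrak a}(S^{-1}M)$; for $S=R\setminus\mathfrak p$ with $\mathfrak p$ prime they are denoted $\rho^{\mathfrak p}_{\mathfrak a}$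 and $\overline\rho^{\mathfrak p}_{\mathfrak a}$. Being an isomorphism means being one for every $R$-module $M$. An ideal $\mathfrak a$ of a ring $R$ is weakly fair if $\operatorname{Ass}^{\mathrm f}_R(M/\Gamma_{\mathfrak a}(M))=\operatorname{Ass}^{\mathrm f}_R(M)\setminus\operatorname{Var}(\mathfrak a)$ for every $R$-module $M$, and weakly large fair if $\operatorname{Ass}^{\mathrm f}_R(M/\overline\Gamma_{\mathfrak a}(M))=\operatorname{Ass}^{\mathrm f}_R(M)\setminus\operatorname{Var}(\mathfrak a)$ for every $R$-module $M$. *)

theory Defs
  imports Complex_Main "HOL-Algebra.Module" "HOL-Algebra.Ideal_Product"
begin

text \<open>
  Modules over a ring \<open>R\<close> are records \<open>M\<close> with \<^prop>\<open>module R M\<close>. The record type inherits the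
  fields \<^const>\<open>mult\<close> and \<^const>\<open>one\<close> from rings; they carry no meaning for modules, and the
  constructions below leave them undefined.
\<close>

section \<open>Primes, annihilators, torsion\<close>

definition Var :: "('a, 'r) ring_scheme \<Rightarrow> 'a set \<Rightarrow> 'a set set" where
  "Var R \<aa> = {\<pp>. primeideal \<pp> R \<and> \<aa> \<subseteq> \<pp>}"

definition min_primes :: "('a, 'r) ring_scheme \<Rightarrow> 'a set \<Rightarrow> 'a set set" where
  "min_primes R \<bb> = {\<pp> \<in> Var R \<bb>. \<forall>\<qq> \<in> Var R \<bb>. \<qq> \<subseteq> \<pp> \<longrightarrow> \<qq> = \<pp>}"

definition ideal_radical :: "('a, 'r) ring_scheme \<Rightarrow> 'a set \<Rightarrow> 'a set" where
  "ideal_radical R \<bb> = {r \<in> carrier R. \<exists>n::nat. r [^]\<^bsub>R\<^esub> n \<in> \<bb>}"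

definition ann :: "('a, 'r) ring_scheme \<Rightarrow> ('a, 'b, 'm) module_scheme \<Rightarrow> 'b \<Rightarrow> 'a set" where
  "ann R M x = {r \<in> carrier R. r \<odot>\<^bsub>M\<^esub> x = \<zero>\<^bsub>M\<^esub>}"

definition small_torsion :: "('a, 'r) ring_scheme \<Rightarrow> 'a set \<Rightarrow> ('a, 'b, 'm) module_scheme \<Rightarrow> 'b set" where
  "small_torsion R \<aa> M = {x \<in> carrier M. \<exists>n::nat. \<aa> [^]\<^bsub>ideals_set R\<^esub> n \<subseteq> ann R M x}"

definition large_torsion :: "('a, 'r) ring_scheme \<Rightarrow> 'a set \<Rightarrow> ('a, 'b, 'm) module_scheme \<Rightarrow> 'b set" where
  "large_torsion R \<aa> M = {x \<in> carrier M. \<aa> \<subseteq> ideal_radical R (ann R M x)}"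

definition weak_assassin :: "('a, 'r) ring_scheme \<Rightarrow> ('a, 'b, 'm) module_scheme \<Rightarrow> 'a set set" where
  "weak_assassin R M = {\<pp>. primeideal \<pp> R \<and> (\<exists>x \<in> carrier M. \<pp> \<in> min_primes R (ann R M x))}"


section \<open>Quotient modules, isomorphisms of modules\<close>

definition quot_module :: "('a, 'b, 'm) module_scheme \<Rightarrow> 'b set \<Rightarrow> ('a, 'b set) module" where
  "quot_module M N =
    \<lparr>carrier = a_rcosets\<^bsub>M\<^esub> N, mult = undefined, one = undefined,
     zero = N, add = set_add M,
     smult = (\<lambda>r X. \<Union>x\<in>X. N +>\<^bsub>M\<^esub> (r \<odot>\<^bsub>M\<^esub> x))\<rparr>"

definition module_iso ::
  "('a, 'r) ring_scheme \<Rightarrow> ('a, 'b, 'm) module_scheme \<Rightarrow> ('a, 'c, 'n) module_scheme \<Rightarrow> ('b \<Rightarrow> 'c) \<Rightarrow> bool" where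
  "module_iso R M N f \<longleftrightarrow>
    f \<in> iso (add_monoid M) (add_monoid N) \<and>
    (\<forall>r \<in> carrier R. \<forall>x \<in> carrier M. f (r \<odot>\<^bsub>M\<^esub> x) = r \<odot>\<^bsub>N\<^esub> f x)"


section \<open>Localisation\<close>

definition mult_closure :: "('a, 'r) ring_scheme \<Rightarrow> 'a set \<Rightarrow> 'a set" where
  "mult_closure R S = (\<lambda>T. submonoid T R) hull S"

text \<open>\<open>frac R M S x s\<close> is the fraction \<open>x / s\<close>, as an equivalence class of pairs.\<close>

definition frac_rel ::
  "('a, 'r) ring_scheme \<Rightarrow> ('a, 'b, 'm) module_scheme \<Rightarrow> 'a set \<Rightarrow> (('b \<times> 'a) \<times> ('b \<times> 'a)) set" where
  "frac_rel R M S =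
    {((x, s), (y, t)). x \<in> carrier M \<and> y \<in> carrier M \<and> s \<in> mult_closure R S \<and> t \<in> mult_closure R S \<and>
       (\<exists>u \<in> mult_closure R S. (u \<otimes>\<^bsub>R\<^esub> t) \<odot>\<^bsub>M\<^esub> x = (u \<otimes>\<^bsub>R\<^esub> s) \<odot>\<^bsub>M\<^esub> y)}"

definition frac ::
  "('a, 'r) ring_scheme \<Rightarrow> ('a, 'b, 'm) module_scheme \<Rightarrow> 'a set \<Rightarrow> 'b \<Rightarrow> 'a \<Rightarrow> ('b \<times> 'a) set" where
  "frac R M S x s = frac_rel R M S `` {(x, s)}"

text \<open>\<open>R\<close> as a module over itself, so that \<open>frac\<close> also yields the elements of \<open>S\<^sup>-\<^sup>1R\<close>.\<close>

definition self_module :: "('a, 'r) ring_scheme \<Rightarrow> ('a, 'a) module" where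
  "self_module R =
    \<lparr>carrier = carrier R, mult = mult R, one = \<one>\<^bsub>R\<^esub>, zero = \<zero>\<^bsub>R\<^esub>, add = add R, smult = mult R\<rparr>"

abbreviation ring_frac :: "('a, 'r) ring_scheme \<Rightarrow> 'a set \<Rightarrow> 'a \<Rightarrow> 'a \<Rightarrow> ('a \<times> 'a) set" where
  "ring_frac R \<equiv> frac R (self_module R)"

definition loc_ring :: "('a, 'r) ring_scheme \<Rightarrow> 'a set \<Rightarrow> ('a \<times> 'a) set ring" where
  "loc_ring R S =
    \<lparr>carrier = (carrier R \<times> mult_closure R S) // frac_rel R (self_module R) S,
     mult = (\<lambda>X Y. \<Union>(x, s)\<in>X. \<Union>(y, t)\<in>Y. ring_frac R S (x \<otimes>\<^bsub>R\<^esub> y) (s \<otimes>\<^bsub>R\<^esub> t)),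
     one = ring_frac R S \<one>\<^bsub>R\<^esub> \<one>\<^bsub>R\<^esub>,
     zero = ring_frac R S \<zero>\<^bsub>R\<^esub> \<one>\<^bsub>R\<^esub>,
     add = (\<lambda>X Y. \<Union>(x, s)\<in>X. \<Union>(y, t)\<in>Y.
              ring_frac R S (t \<otimes>\<^bsub>R\<^esub> x \<oplus>\<^bsub>R\<^esub> s \<otimes>\<^bsub>R\<^esub> y) (s \<otimes>\<^bsub>R\<^esub> t))\<rparr>"

definition loc_ideal :: "('a, 'r) ring_scheme \<Rightarrow> 'a set \<Rightarrow> 'a set \<Rightarrow> ('a \<times> 'a) set set" where
  "loc_ideal R S \<aa> = {ring_frac R S x s | x s. x \<in> \<aa> \<and> s \<in> mult_closure R S}"

definition loc_module ::
  "('a, 'r) ring_scheme \<Rightarrow> 'a set \<Rightarrow> ('a, 'b, 'm) module_scheme \<Rightarrow> (('a \<times> 'a) set, ('b \<times> 'a) set) module" where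
  "loc_module R S M =
    \<lparr>carrier = (carrier M \<times> mult_closure R S) // frac_rel R M S,
     mult = undefined, one = undefined,
     zero = frac R M S \<zero>\<^bsub>M\<^esub> \<one>\<^bsub>R\<^esub>,
     add = (\<lambda>X Y. \<Union>(x, s)\<in>X. \<Union>(y, t)\<in>Y.
              frac R M S (t \<odot>\<^bsub>M\<^esub> x \<oplus>\<^bsub>M\<^esub> s \<odot>\<^bsub>M\<^esub> y) (s \<otimes>\<^bsub>R\<^esub> t)),
     smult = (\<lambda>A X. \<Union>(r, s)\<in>A. \<Union>(x, t)\<in>X. frac R M S (r \<odot>\<^bsub>M\<^esub> x) (s \<otimes>\<^bsub>R\<^esub> t))\<rparr>"


section \<open>The canonical morphisms $\rho$ and $\overline\rho$\<close>

text \<open>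
  For a submodule \<open>N\<close> of \<open>M\<close>, \<open>loc_incl R S M\<close> is the map \<open>S\<^sup>-\<^sup>1N \<rightarrow> S\<^sup>-\<^sup>1M\<close> induced by the inclusion:
  it sends the class of \<open>(x, s)\<close> in \<open>S\<^sup>-\<^sup>1N\<close> to the class of \<open>(x, s)\<close> in \<open>S\<^sup>-\<^sup>1M\<close>.

  In this and the next section, \<open>every R-module\<close> means every \<open>R\<close>-module with carrier in the type
  \<open>'b\<close>, since HOL cannot quantify over types inside a formula; results are stated for an arbitrary
  \<open>'b\<close>. All four properties below can be tested on cyclic modules, so they agree with the
  unrestricted ones as soon as \<open>'b\<close> has room for every quotient of \<open>R\<close>, for instance for \<open>'b = 'a\<close>.
\<close>

definition loc_incl ::
  "('a, 'r) ring_scheme \<Rightarrow> 'a set \<Rightarrow> ('a, 'b, 'm) module_scheme \<Rightarrow> ('b \<times> 'a) set \<Rightarrow> ('b \<times> 'a) set" where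
  "loc_incl R S M X = (\<Union>(x, s)\<in>X. frac R M S x s)"

definition rho_iso :: "'b itself \<Rightarrow> ('a, 'r) ring_scheme \<Rightarrow> 'a set \<Rightarrow> 'a set \<Rightarrow> bool" where
  "rho_iso _ R S \<aa> \<longleftrightarrow>
    (\<forall>M :: ('a, 'b) module. module R M \<longrightarrow>
       module_iso (loc_ring R S)
         (loc_module R S (M\<lparr>carrier := small_torsion R \<aa> M\<rparr>))
         ((loc_module R S M)
            \<lparr>carrier := small_torsion (loc_ring R S) (loc_ideal R S \<aa>) (loc_module R S M)\<rparr>)
         (loc_incl R S M))"

definition rho_bar_iso :: "'b itself \<Rightarrow> ('a, 'r) ring_scheme \<Rightarrow> 'a set \<Rightarrow> 'a set \<Rightarrow> bool" where
  "rho_bar_iso _ R S \<aa> \<longleftrightarrow>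
    (\<forall>M :: ('a, 'b) module. module R M \<longrightarrow>
       module_iso (loc_ring R S)
         (loc_module R S (M\<lparr>carrier := large_torsion R \<aa> M\<rparr>))
         ((loc_module R S M)
            \<lparr>carrier := large_torsion (loc_ring R S) (loc_ideal R S \<aa>) (loc_module R S M)\<rparr>)
         (loc_incl R S M))"


section \<open>Weak fairness\<close>

definition weakly_fair :: "'b itself \<Rightarrow> ('a, 'r) ring_scheme \<Rightarrow> 'a set \<Rightarrow> bool" where
  "weakly_fair _ R \<aa> \<longleftrightarrow>
    (\<forall>M :: ('a, 'b) module. module R M \<longrightarrow>
       weak_assassin R (quot_module M (small_torsion R \<aa> M)) = weak_assassin R M - Var R \<aa>)"

definition weakly_large_fair :: "'b itself \<Rightarrow> ('a, 'r) ring_scheme \<Rightarrow> 'a set \<Rightarrow> bool" where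
  "weakly_large_fair _ R \<aa> \<longleftrightarrow>
    (\<forall>M :: ('a, 'b) module. module R M \<longrightarrow>
       weak_assassin R (quot_module M (large_torsion R \<aa> M)) = weak_assassin R M - Var R \<aa>)"

end

theory Submission
  imports Defs
begin

text \<open>
  Both torsion functors have the form \<open>\<Gamma>(M) = {x \<in> M | ann x \<in> \<tau>}\<close> for a filter \<open>\<tau>\<close> of ideals: the
  ideals containing a power of \<open>\<aa>\<close>, respectively the ideals whose radical contains \<open>\<aa>\<close>. Everything
  is therefore proved once, for an arbitrary filter, and fairness is read elementwise: a prime is
  weakly associated with \<open>M/G\<close> iff it is minimal over some \<open>(G : x) = {r | r x \<in> G}\<close>.

  Descent to \<open>S\<^sup>-\<^sup>1R\<close> is restriction of scalars (\<open>fair_wrt_localisation\<close>). An \<open>S\<^sup>-\<^sup>1R\<close>-module \<open>M\<close> regarded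
  as an \<open>R\<close>-module has the same torsion, since the filter over \<open>S\<^sup>-\<^sup>1R\<close> consists of the ideals whose
  contraction lies in the filter over \<open>R\<close> (\<open>small_filter_ext\<close>, \<open>large_filter_ext\<close>). Moreover \<open>(G : x)\<close>
  over \<open>R\<close> is the contraction of \<open>(G : x)\<close> over \<open>S\<^sup>-\<^sup>1R\<close>, and contraction preserves and reflects minimal
  primes (\<open>min_primes_contr\<close>). So the fairness identity for the restricted module, tested at contracted
  primes, is the identity for \<open>M\<close>.

  Conversely, let \<open>\<pp>\<close> be a prime of \<open>R\<close>, contained in a maximal ideal \<open>\<mm>\<close>. Since
  \<open>(S\<^sup>-\<^sup>1G : x/s) = S\<^sup>-\<^sup>1(G : x)\<close>, the prime \<open>\<pp>\<close> is weakly associated with \<open>M/G\<close> iff \<open>\<pp>\<^sub>\<mm>\<close> is weakly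
  associated with \<open>M\<^sub>\<mm>/G\<^sub>\<mm>\<close> (\<open>rel_assassin_loc\<close>). For \<open>G = \<Gamma>(M)\<close> surjectivity of \<open>\<rho>\<close> identifies \<open>G\<^sub>\<mm>\<close> with
  the torsion of \<open>M\<^sub>\<mm>\<close>, and fairness of \<open>\<aa>\<^sub>\<mm>\<close> applies.

  There remains a question of size: fairness over \<open>R\<^sub>\<mm>\<close> speaks of modules whose carrier lies in the
  type \<open>'b\<close>, whereas the elements of \<open>M\<^sub>\<mm>\<close> are classes of pairs. The assassin of \<open>M/G\<close> is the union
  of those of its cyclic submodules (\<open>rel_assassin_eq_cyclic\<close>), and a localisation of a cyclic module
  is at most as large as the module (\<open>cyclic_loc_inj\<close>), so a copy of it can be built inside \<open>'b\<close>
  (\<open>fair_wrt_transport\<close>).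
\<close>

section \<open>Localised rings and modules\<close>

lemma (in cring) module_self: "module R (self_module R)"
  by (rule moduleI)
    (auto simp: self_module_def cring_axioms l_distr r_distr m_assoc a_assoc
      intro!: abelian_groupI a_comm bexI[of _ "\<ominus> _"] l_neg)

locale localisation = cring R for R (structure) +
  fixes S
  assumes S_subset: "S \<subseteq> carrier R"
begin

abbreviation T where "T \<equiv> mult_closure R S"
abbreviation A where "A \<equiv> loc_ring R S"
abbreviation L where "L \<equiv> loc_module R S"
abbreviation ext where "ext \<equiv> loc_ideal R S"
abbreviation \<phi> where "\<phi> r \<equiv> ring_frac R S r \<one>"

lemma submonoid_T: "submonoid T R"
  unfolding mult_closure_def hull_def
  using S_subset by (auto intro!: submonoid.intro dest: submonoid.subset submonoid.m_closed
      submonoid.one_closed)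

lemma T_carrier [simp]: "s \<in> T \<Longrightarrow> s \<in> carrier R"
  and one_T [simp]: "\<one> \<in> T"
  and mult_T [simp]: "s \<in> T \<Longrightarrow> t \<in> T \<Longrightarrow> s \<otimes> t \<in> T"
  using submonoid_T by (auto dest: submonoid.subset submonoid.m_closed submonoid.one_closed)

lemma frac_rel_iff:
  "((x, s), (y, t)) \<in> frac_rel R M S \<longleftrightarrow> x \<in> carrier M \<and> y \<in> carrier M \<and> s \<in> T \<and> t \<in> T \<and>
     (\<exists>u \<in> T. (u \<otimes> t) \<odot>\<^bsub>M\<^esub> x = (u \<otimes> s) \<odot>\<^bsub>M\<^esub> y)"
  by (simp add: frac_rel_def)

lemma equiv_frac_rel:
  assumes "module R M"
  shows "equiv (carrier M \<times> T) (frac_rel R M S)"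
proof (rule equivI)
  interpret M: module R M by fact
  show "frac_rel R M S \<subseteq> (carrier M \<times> T) \<times> carrier M \<times> T"
    by (auto simp: frac_rel_def)
  show "refl_on (carrier M \<times> T) (frac_rel R M S)"
    by (auto simp: refl_on_def frac_rel_iff)
  show "sym (frac_rel R M S)"
    by (auto simp: sym_def frac_rel_iff) (metis)
  show "trans (frac_rel R M S)"
  proof (clarsimp simp: trans_def frac_rel_iff)
    fix x s y t z r u v
    assume *: "x \<in> carrier M" "y \<in> carrier M" "z \<in> carrier M" "s \<in> T" "t \<in> T" "r \<in> T" "u \<in> T" "v \<in> T"
      and 1: "(u \<otimes> t) \<odot>\<^bsub>M\<^esub> x = (u \<otimes> s) \<odot>\<^bsub>M\<^esub> y" and 2: "(v \<otimes> r) \<odot>\<^bsub>M\<^esub> y = (v \<otimes> t) \<odot>\<^bsub>M\<^esub> z"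
    have "((u \<otimes> v \<otimes> t) \<otimes> r) \<odot>\<^bsub>M\<^esub> x = (v \<otimes> r) \<odot>\<^bsub>M\<^esub> ((u \<otimes> t) \<odot>\<^bsub>M\<^esub> x)"
      using * by (simp add: M.smult_assoc1[symmetric] m_ac)
    also have "\<dots> = (u \<otimes> s) \<odot>\<^bsub>M\<^esub> ((v \<otimes> r) \<odot>\<^bsub>M\<^esub> y)"
      unfolding 1 using * by (simp add: M.smult_assoc1[symmetric] m_ac)
    also have "\<dots> = ((u \<otimes> v \<otimes> t) \<otimes> s) \<odot>\<^bsub>M\<^esub> z"
      unfolding 2 using * by (simp add: M.smult_assoc1[symmetric] m_ac)
    finally show "\<exists>u\<in>T. (u \<otimes> r) \<odot>\<^bsub>M\<^esub> x = (u \<otimes> s) \<odot>\<^bsub>M\<^esub> z"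
      using * by (meson mult_T)
  qed
qed

lemma frac_eq_iff:
  assumes "module R M" "x \<in> carrier M" "y \<in> carrier M" "s \<in> T" "t \<in> T"
  shows "frac R M S x s = frac R M S y t \<longleftrightarrow> (\<exists>u \<in> T. (u \<otimes> t) \<odot>\<^bsub>M\<^esub> x = (u \<otimes> s) \<odot>\<^bsub>M\<^esub> y)"
  unfolding frac_def using equiv_frac_rel[OF assms(1)] assms
  by (simp add: eq_equiv_class_iff frac_rel_iff)

lemma frac_eqI:
  assumes "module R M" "x \<in> carrier M" "y \<in> carrier M" "s \<in> T" "t \<in> T" "t \<odot>\<^bsub>M\<^esub> x = s \<odot>\<^bsub>M\<^esub> y"
  shows "frac R M S x s = frac R M S y t"
  using assms by (auto simp: frac_eq_iff intro: bexI[of _ \<one>])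

lemma frac_closed [simp]:
  "x \<in> carrier M \<Longrightarrow> s \<in> T \<Longrightarrow> frac R M S x s \<in> carrier (L M)"
  by (simp add: loc_module_def frac_def quotientI)

lemma loc_carrierE:
  assumes "X \<in> carrier (L M)"
  obtains x s where "x \<in> carrier M" "s \<in> T" "X = frac R M S x s"
  using assms by (auto simp: loc_module_def frac_def elim!: quotientE)

lemma loc_zero: "\<zero>\<^bsub>L M\<^esub> = frac R M S \<zero>\<^bsub>M\<^esub> \<one>"
  by (simp add: loc_module_def)

lemma frac_add:
  assumes "module R M" "x \<in> carrier M" "y \<in> carrier M" "s \<in> T" "t \<in> T"
  shows "frac R M S x s \<oplus>\<^bsub>L M\<^esub> frac R M S y t = frac R M S (t \<odot>\<^bsub>M\<^esub> x \<oplus>\<^bsub>M\<^esub> s \<odot>\<^bsub>M\<^esub> y) (s \<otimes> t)"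
proof -
  interpret M: module R M by fact
  let ?f = "\<lambda>(x, s) (y, t). frac R M S (t \<odot>\<^bsub>M\<^esub> x \<oplus>\<^bsub>M\<^esub> s \<odot>\<^bsub>M\<^esub> y) (s \<otimes> t)"
  have comm: "?f p q = ?f q p" if "p \<in> carrier M \<times> T" "q \<in> carrier M \<times> T" for p q
    using that by (auto simp: m_comm M.a_comm)
  have "congruent2 (frac_rel R M S) (frac_rel R M S) ?f"
  proof (rule congruent2_commuteI[OF equiv_frac_rel[OF assms(1)]])
    show "?f y z = ?f z y" if "y \<in> carrier M \<times> T" "z \<in> carrier M \<times> T" for y z
      using comm that by blast
    show "?f w y = ?f w z" if "w \<in> carrier M \<times> T" "(y, z) \<in> frac_rel R M S" for y z w
    proof -
      obtain x r y' s z' t where eqs: "w = (x, r)" "y = (y', s)" "z = (z', t)"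
        by (metis surj_pair)
      then obtain u where *: "x \<in> carrier M" "y' \<in> carrier M" "z' \<in> carrier M" "r \<in> T" "s \<in> T" "t \<in> T" "u \<in> T"
        and 1: "(u \<otimes> t) \<odot>\<^bsub>M\<^esub> y' = (u \<otimes> s) \<odot>\<^bsub>M\<^esub> z'"
        using \<open>w \<in> _\<close> \<open>(y, z) \<in> _\<close> by (auto simp: frac_rel_iff)
      have "(u \<otimes> (r \<otimes> t)) \<odot>\<^bsub>M\<^esub> (s \<odot>\<^bsub>M\<^esub> x \<oplus>\<^bsub>M\<^esub> r \<odot>\<^bsub>M\<^esub> y')
          = (u \<otimes> r \<otimes> t \<otimes> s) \<odot>\<^bsub>M\<^esub> x \<oplus>\<^bsub>M\<^esub> (r \<otimes> r) \<odot>\<^bsub>M\<^esub> ((u \<otimes> t) \<odot>\<^bsub>M\<^esub> y')"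
        using * by (simp add: M.smult_r_distr M.smult_assoc1[symmetric] m_ac)
      also have "\<dots> = (u \<otimes> (r \<otimes> s)) \<odot>\<^bsub>M\<^esub> (t \<odot>\<^bsub>M\<^esub> x \<oplus>\<^bsub>M\<^esub> r \<odot>\<^bsub>M\<^esub> z')"
        unfolding 1 using * by (simp add: M.smult_r_distr M.smult_assoc1[symmetric] m_ac)
      finally show ?thesis
        using * by (auto simp: eqs frac_eq_iff assms)
    qed
  qed
  then show ?thesis
    using UN_equiv_class2[OF equiv_frac_rel[OF assms(1)] equiv_frac_rel[OF assms(1)],
        of ?f "(x, s)" "(y, t)"] assms
    by (simp add: loc_module_def frac_def split_def)
qed

lemma self_module_simps [simp]:
  "carrier (self_module R) = carrier R" "smult (self_module R) = mult R"
  "zero (self_module R) = \<zero>" "add (self_module R) = add R"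
  by (simp_all add: self_module_def)

lemma frac_smult:
  assumes "module R M" "r \<in> carrier R" "x \<in> carrier M" "s \<in> T" "t \<in> T"
  shows "ring_frac R S r s \<odot>\<^bsub>L M\<^esub> frac R M S x t = frac R M S (r \<odot>\<^bsub>M\<^esub> x) (s \<otimes> t)"
proof -
  interpret M: module R M by fact
  let ?f = "\<lambda>(r, s) (x, t). frac R M S (r \<odot>\<^bsub>M\<^esub> x) (s \<otimes> t)"
  let ?R = "frac_rel R (self_module R) S"
  have eqR: "equiv (carrier R \<times> T) ?R"
    using equiv_frac_rel[OF module_self] by simp
  have "congruent2 ?R (frac_rel R M S) ?f"
  proof (rule congruent2I'; clarsimp simp: frac_rel_iff)
    fix a s b t x p y q u v
    assume *: "a \<in> carrier R" "b \<in> carrier R" "x \<in> carrier M" "y \<in> carrier M"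
      "s \<in> T" "t \<in> T" "p \<in> T" "q \<in> T" "u \<in> T" "v \<in> T"
      and 1: "u \<otimes> t \<otimes> a = u \<otimes> s \<otimes> b" and 2: "(v \<otimes> q) \<odot>\<^bsub>M\<^esub> x = (v \<otimes> p) \<odot>\<^bsub>M\<^esub> y"
    have "(u \<otimes> v \<otimes> (t \<otimes> q)) \<odot>\<^bsub>M\<^esub> (a \<odot>\<^bsub>M\<^esub> x) = (u \<otimes> t \<otimes> a) \<odot>\<^bsub>M\<^esub> ((v \<otimes> q) \<odot>\<^bsub>M\<^esub> x)"
      using * by (simp add: M.smult_assoc1[symmetric] m_ac)
    also have "\<dots> = (u \<otimes> v \<otimes> (s \<otimes> p)) \<odot>\<^bsub>M\<^esub> (b \<odot>\<^bsub>M\<^esub> y)"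
      unfolding 1 2 using * by (simp add: M.smult_assoc1[symmetric] m_ac)
    finally show "frac R M S (a \<odot>\<^bsub>M\<^esub> x) (s \<otimes> p) = frac R M S (b \<odot>\<^bsub>M\<^esub> y) (t \<otimes> q)"
      using * by (subst frac_eq_iff) (auto simp: assms intro: mult_T)
  qed
  then show ?thesis
    using UN_equiv_class2[OF eqR equiv_frac_rel[OF assms(1)], of ?f "(r, s)" "(x, t)"] assms
    by (simp add: loc_module_def frac_def split_def)
qed

text \<open>
  Addition, zero and multiplication of \<open>S\<^sup>-\<^sup>1R\<close> are addition, zero and scalar multiplication of the
  localised module \<open>S\<^sup>-\<^sup>1R\<close>, so the ring axioms are instances of the module identities below.
\<close>

lemma loc_ring_simps:
  "carrier A = carrier (L (self_module R))" "add A = add (L (self_module R))"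
  "mult A = smult (L (self_module R))" "zero A = \<zero>\<^bsub>L (self_module R)\<^esub>" "one A = \<phi> \<one>"
  by (simp_all add: loc_ring_def loc_module_def self_module_def)

lemma loc_abelian_group:
  assumes "module R M"
  shows "abelian_group (L M)"
proof -
  interpret M: module R M by fact
  note [simp] = assms frac_add loc_zero
  show ?thesis
  proof (rule abelian_groupI)
    fix X Y assume "X \<in> carrier (L M)" "Y \<in> carrier (L M)"
    then obtain x s y t where *: "x \<in> carrier M" "y \<in> carrier M" "s \<in> T" "t \<in> T"
      "X = frac R M S x s" "Y = frac R M S y t"
      by (elim loc_carrierE)
    show "X \<oplus>\<^bsub>L M\<^esub> Y \<in> carrier (L M)" using * by simp
    show "X \<oplus>\<^bsub>L M\<^esub> Y = Y \<oplus>\<^bsub>L M\<^esub> X" using * by (simp add: M.a_comm m_comm)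
    show "\<zero>\<^bsub>L M\<^esub> \<oplus>\<^bsub>L M\<^esub> X = X" using * by simp
    show "\<exists>Y\<in>carrier (L M). Y \<oplus>\<^bsub>L M\<^esub> X = \<zero>\<^bsub>L M\<^esub>"
    proof (rule bexI)
      show "frac R M S (\<ominus>\<^bsub>M\<^esub> x) s \<oplus>\<^bsub>L M\<^esub> X = \<zero>\<^bsub>L M\<^esub>"
        unfolding *(5) loc_zero using *(1,3)
        by (simp add: M.smult_r_minus M.l_neg del: loc_zero) (rule frac_eqI, simp_all)
    qed (use * in simp)
    fix Z assume "Z \<in> carrier (L M)"
    then obtain z r where **: "z \<in> carrier M" "r \<in> T" "Z = frac R M S z r"
      by (elim loc_carrierE)
    show "(X \<oplus>\<^bsub>L M\<^esub> Y) \<oplus>\<^bsub>L M\<^esub> Z = X \<oplus>\<^bsub>L M\<^esub> (Y \<oplus>\<^bsub>L M\<^esub> Z)"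
      using * ** by (simp add: M.smult_r_distr M.smult_assoc1[symmetric] m_ac M.a_assoc)
  qed simp
qed

lemma loc_smult_closed:
  assumes "module R M" "a \<in> carrier A" "X \<in> carrier (L M)"
  shows "a \<odot>\<^bsub>L M\<^esub> X \<in> carrier (L M)"
proof -
  interpret M: module R M by fact
  show ?thesis
    using assms by (auto simp: loc_ring_simps frac_smult elim!: loc_carrierE)
qed

lemma loc_smult_axioms:
  assumes "module R M" "a \<in> carrier A" "b \<in> carrier A" "X \<in> carrier (L M)" "Y \<in> carrier (L M)"
  shows "(a \<oplus>\<^bsub>A\<^esub> b) \<odot>\<^bsub>L M\<^esub> X = a \<odot>\<^bsub>L M\<^esub> X \<oplus>\<^bsub>L M\<^esub> b \<odot>\<^bsub>L M\<^esub> X"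
    and "a \<odot>\<^bsub>L M\<^esub> (X \<oplus>\<^bsub>L M\<^esub> Y) = a \<odot>\<^bsub>L M\<^esub> X \<oplus>\<^bsub>L M\<^esub> a \<odot>\<^bsub>L M\<^esub> Y"
    and "(a \<otimes>\<^bsub>A\<^esub> b) \<odot>\<^bsub>L M\<^esub> X = a \<odot>\<^bsub>L M\<^esub> (b \<odot>\<^bsub>L M\<^esub> X)"
    and "\<one>\<^bsub>A\<^esub> \<odot>\<^bsub>L M\<^esub> X = X"
proof -
  interpret M: module R M by fact
  note [simp] = assms(1) frac_add frac_smult module_self loc_ring_simps
    frac_add[OF module_self, simplified] frac_smult[OF module_self, simplified]
  obtain p u q v where 1: "p \<in> carrier R" "q \<in> carrier R" "u \<in> T" "v \<in> T"
    "a = ring_frac R S p u" "b = ring_frac R S q v"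
    using assms(2,3) by (auto elim!: loc_carrierE)
  obtain x s y t where 2: "x \<in> carrier M" "y \<in> carrier M" "s \<in> T" "t \<in> T"
    "X = frac R M S x s" "Y = frac R M S y t"
    using assms(4,5) by (elim loc_carrierE)
  show "(a \<oplus>\<^bsub>A\<^esub> b) \<odot>\<^bsub>L M\<^esub> X = a \<odot>\<^bsub>L M\<^esub> X \<oplus>\<^bsub>L M\<^esub> b \<odot>\<^bsub>L M\<^esub> X"
    using 1 2 by (simp, intro frac_eqI) (simp_all add: M.smult_r_distr M.smult_l_distr
        r_distr l_distr M.smult_assoc1[symmetric] m_ac)
  show "a \<odot>\<^bsub>L M\<^esub> (X \<oplus>\<^bsub>L M\<^esub> Y) = a \<odot>\<^bsub>L M\<^esub> X \<oplus>\<^bsub>L M\<^esub> a \<odot>\<^bsub>L M\<^esub> Y"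
    using 1 2 by (simp, intro frac_eqI) (simp_all add: M.smult_r_distr M.smult_assoc1[symmetric] m_ac)
  show "(a \<otimes>\<^bsub>A\<^esub> b) \<odot>\<^bsub>L M\<^esub> X = a \<odot>\<^bsub>L M\<^esub> (b \<odot>\<^bsub>L M\<^esub> X)"
    using 1 2 by (simp add: M.smult_assoc1[symmetric] m_ac)
  show "\<one>\<^bsub>A\<^esub> \<odot>\<^bsub>L M\<^esub> X = X"
    using 2 by simp
qed

lemma cring_loc: "cring A"
proof (rule cringI)
  have comm: "a \<otimes>\<^bsub>A\<^esub> b = b \<otimes>\<^bsub>A\<^esub> a" if "a \<in> carrier A" "b \<in> carrier A" for a b
    using that by (auto simp: loc_ring_simps frac_smult[OF module_self] m_ac elim!: loc_carrierE)
  have one: "\<one>\<^bsub>A\<^esub> \<in> carrier A" by (simp add: loc_ring_simps)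
  have ag: "abelian_group (L (self_module R))"
    by (rule loc_abelian_group[OF module_self])
  show "abelian_group A"
    by (rule abelian_groupI)
      (use abelian_groupE[OF ag] in \<open>simp_all add: loc_ring_simps\<close>)
  have closed: "a \<in> carrier A \<Longrightarrow> a \<in> carrier (L (self_module R))" for a
    by (simp add: loc_ring_simps)
  show "comm_monoid A"
  proof (rule comm_monoidI)
    fix a b c assume *: "a \<in> carrier A" "b \<in> carrier A" "c \<in> carrier A"
    note ax = loc_smult_axioms[OF module_self *(1,2) closed[OF *(3)] closed[OF *(3)]]
    show "a \<otimes>\<^bsub>A\<^esub> b \<in> carrier A"
      using loc_smult_closed[OF module_self *(1) closed[OF *(2)]] by (simp only: loc_ring_simps)
    show "a \<otimes>\<^bsub>A\<^esub> b \<otimes>\<^bsub>A\<^esub> c = a \<otimes>\<^bsub>A\<^esub> (b \<otimes>\<^bsub>A\<^esub> c)"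
      using ax(3) by (simp only: loc_ring_simps)
    show "a \<otimes>\<^bsub>A\<^esub> b = b \<otimes>\<^bsub>A\<^esub> a" by (rule comm[OF *(1,2)])
  next
    fix a assume a: "a \<in> carrier A"
    show "\<one>\<^bsub>A\<^esub> \<otimes>\<^bsub>A\<^esub> a = a"
      using loc_smult_axioms(4)[OF module_self one one closed[OF a] closed[OF a]]
      by (simp only: loc_ring_simps)
  qed (rule one)
  fix a b c assume *: "a \<in> carrier A" "b \<in> carrier A" "c \<in> carrier A"
  show "(a \<oplus>\<^bsub>A\<^esub> b) \<otimes>\<^bsub>A\<^esub> c = a \<otimes>\<^bsub>A\<^esub> c \<oplus>\<^bsub>A\<^esub> b \<otimes>\<^bsub>A\<^esub> c"
    using loc_smult_axioms(1)[OF module_self *(1,2) closed[OF *(3)] closed[OF *(3)]]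
    by (simp only: loc_ring_simps)
qed

lemma module_loc:
  assumes "module R M"
  shows "module A (L M)"
proof (rule moduleI[OF cring_loc loc_abelian_group[OF assms] loc_smult_closed[OF assms]])
  interpret A: cring A by (rule cring_loc)
  fix a b X Y assume "a \<in> carrier A" "b \<in> carrier A" "X \<in> carrier (L M)" "Y \<in> carrier (L M)"
  note ax = loc_smult_axioms[OF assms this]
  show "(a \<oplus>\<^bsub>A\<^esub> b) \<odot>\<^bsub>L M\<^esub> X = a \<odot>\<^bsub>L M\<^esub> X \<oplus>\<^bsub>L M\<^esub> b \<odot>\<^bsub>L M\<^esub> X"
    "a \<odot>\<^bsub>L M\<^esub> (X \<oplus>\<^bsub>L M\<^esub> Y) = a \<odot>\<^bsub>L M\<^esub> X \<oplus>\<^bsub>L M\<^esub> a \<odot>\<^bsub>L M\<^esub> Y"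
    "(a \<otimes>\<^bsub>A\<^esub> b) \<odot>\<^bsub>L M\<^esub> X = a \<odot>\<^bsub>L M\<^esub> (b \<odot>\<^bsub>L M\<^esub> X)"
    by (rule ax)+
next
  interpret A: cring A by (rule cring_loc)
  fix X assume X: "X \<in> carrier (L M)"
  show "\<one>\<^bsub>A\<^esub> \<odot>\<^bsub>L M\<^esub> X = X"
    by (rule loc_smult_axioms(4)[OF assms A.one_closed A.one_closed X X])
qed

end

section \<open>Assassins of quotients\<close>

definition colon :: "('a, 'r) ring_scheme \<Rightarrow> ('a, 'b, 'm) module_scheme \<Rightarrow> 'b set \<Rightarrow> 'b \<Rightarrow> 'a set" where
  "colon R M G x = {r \<in> carrier R. r \<odot>\<^bsub>M\<^esub> x \<in> G}"

definition rel_assassin :: "('a, 'r) ring_scheme \<Rightarrow> ('a, 'b, 'm) module_scheme \<Rightarrow> 'b set \<Rightarrow> 'a set set" where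
  "rel_assassin R M G = {\<pp>. primeideal \<pp> R \<and> (\<exists>x \<in> carrier M. \<pp> \<in> min_primes R (colon R M G x))}"

lemma ann_eq_colon: "ann R M x = colon R M {\<zero>\<^bsub>M\<^esub>} x"
  by (simp add: ann_def colon_def)

lemma weak_assassin_eq: "weak_assassin R M = rel_assassin R M {\<zero>\<^bsub>M\<^esub>}"
  by (simp add: weak_assassin_def rel_assassin_def ann_eq_colon)

lemma (in module) ideal_colon:
  assumes "submodule G R M" "x \<in> carrier M"
  shows "ideal (colon R M G x) R"
proof (rule idealI[OF ring_axioms])
  interpret G: submodule G R M by fact
  show "subgroup (colon R M G x) (add_monoid R)"
  proof (rule R.add.subgroupI)
    show "colon R M G x \<noteq> {}"
      using assms G.one_closed by (auto simp: colon_def intro!: exI[of _ \<zero>])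
    show "\<ominus> a \<in> colon R M G x" if "a \<in> colon R M G x" for a
      using that assms G.m_inv_closed[of "a \<odot>\<^bsub>M\<^esub> x"]
      by (auto simp: colon_def smult_l_minus a_inv_def[symmetric])
    show "a \<oplus> b \<in> colon R M G x" if "a \<in> colon R M G x" "b \<in> colon R M G x" for a b
      using that assms G.m_closed by (auto simp: colon_def smult_l_distr)
  qed (auto simp: colon_def)
  show *: "r \<otimes> a \<in> colon R M G x" if "a \<in> colon R M G x" "r \<in> carrier R" for a r
    using that assms by (auto simp: colon_def smult_assoc1)
  show "a \<otimes> r \<in> colon R M G x" if "a \<in> colon R M G x" "r \<in> carrier R" for a r
    using *[OF that] that by (simp add: colon_def m_comm)
qed

lemma (in module) submodule_zero: "submodule {\<zero>\<^bsub>M\<^esub>} R M"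
  by (rule submoduleI) auto

text \<open>
  The annihilator of the coset of \<open>x\<close> in \<open>M/G\<close> is \<open>(G : x)\<close>; this removes quotient modules from all
  later arguments.
\<close>

lemma (in module) weak_assassin_quot:
  assumes "submodule G R M"
  shows "weak_assassin R (quot_module M G) = rel_assassin R M G"
proof -
  interpret G: submodule G R M by fact
  interpret abelian_subgroup G M
    by (rule abelian_subgroupI3)
      (auto intro: additive_subgroup.intro G.subgroup_axioms abelian_group_axioms)
  have "ann R (quot_module M G) (G +>\<^bsub>M\<^esub> x) = colon R M G x" if x: "x \<in> carrier M" for x
  proof -
    have "(\<Union>y\<in>G +>\<^bsub>M\<^esub> x. G +>\<^bsub>M\<^esub> (r \<odot>\<^bsub>M\<^esub> y)) = G +>\<^bsub>M\<^esub> (r \<odot>\<^bsub>M\<^esub> x)" if r: "r \<in> carrier R" for r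
    proof -
      have "G +>\<^bsub>M\<^esub> (r \<odot>\<^bsub>M\<^esub> y) = G +>\<^bsub>M\<^esub> (r \<odot>\<^bsub>M\<^esub> x)" if "y \<in> G +>\<^bsub>M\<^esub> x" for y
      proof -
        obtain g where g: "g \<in> G" "y = g \<oplus>\<^bsub>M\<^esub> x"
          using \<open>y \<in> _\<close> by (auto simp: a_r_coset_def')
        then have "r \<odot>\<^bsub>M\<^esub> y \<in> G +>\<^bsub>M\<^esub> (r \<odot>\<^bsub>M\<^esub> x)"
          using x r a_Hcarr by (auto simp: a_r_coset_def' smult_r_distr)
        then show ?thesis
          using a_repr_independence' x r by (metis smult_closed)
      qed
      moreover have "x \<in> G +>\<^bsub>M\<^esub> x" using x by (rule a_rcos_self)
      ultimately show ?thesis by blast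
    qed
    moreover have "G +>\<^bsub>M\<^esub> y = G \<longleftrightarrow> y \<in> G" if "y \<in> carrier M" for y
      using that a_rcos_self[of y] a_rcos_const by blast
    ultimately show ?thesis
      using x unfolding ann_def colon_def by (intro Collect_cong conj_cong refl) (simp add: quot_module_def)
  qed
  moreover have "carrier (quot_module M G) = (\<lambda>x. G +>\<^bsub>M\<^esub> x) ` carrier M"
    by (auto simp: quot_module_def A_RCOSETS_def')
  ultimately show ?thesis
    by (auto simp: weak_assassin_def rel_assassin_def)
qed

section \<open>Torsion with respect to a filter of ideals\<close>

text \<open>
  Exactly the closure properties that make the elements with annihilator in \<open>\<tau>\<close> a submodule:
  \<open>ann x \<inter> ann y \<subseteq> ann (x + y)\<close> and \<open>ann x \<subseteq> ann (r x)\<close>.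
\<close>

definition ideal_filter :: "('a, 'r) ring_scheme \<Rightarrow> ('a set \<Rightarrow> bool) \<Rightarrow> bool" where
  "ideal_filter R \<tau> \<longleftrightarrow> \<tau> (carrier R) \<and>
     (\<forall>I J. ideal I R \<longrightarrow> ideal J R \<longrightarrow> \<tau> I \<longrightarrow> I \<subseteq> J \<longrightarrow> \<tau> J) \<and>
     (\<forall>I J. ideal I R \<longrightarrow> ideal J R \<longrightarrow> \<tau> I \<longrightarrow> \<tau> J \<longrightarrow> \<tau> (I \<inter> J))"

definition torsion :: "('a, 'r) ring_scheme \<Rightarrow> ('a set \<Rightarrow> bool) \<Rightarrow> ('a, 'b, 'm) module_scheme \<Rightarrow> 'b set" where
  "torsion R \<tau> M = {x \<in> carrier M. \<tau> (ann R M x)}"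

lemma (in module) submodule_torsion:
  assumes "ideal_filter R \<tau>"
  shows "submodule (torsion R \<tau> M) R M"
proof -
  have id: "ideal (ann R M x) R" if "x \<in> carrier M" for x
    using that by (simp add: ann_eq_colon ideal_colon submodule_zero)
  have mono: "\<tau> (ann R M y)" if "\<tau> (ann R M x)" "x \<in> carrier M" "y \<in> carrier M" "ann R M x \<subseteq> ann R M y" for x y
    using assms that id[of x] id[of y] unfolding ideal_filter_def by blast
  show ?thesis
  proof (rule submoduleI)
    show "\<zero>\<^bsub>M\<^esub> \<in> torsion R \<tau> M"
      using assms by (simp add: torsion_def ideal_filter_def ann_def Collect_conj_eq Int_absorb2 Collect_mem_eq subsetI)
    show "\<ominus>\<^bsub>M\<^esub> x \<in> torsion R \<tau> M" if "x \<in> torsion R \<tau> M" for x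
      using that by (auto simp: torsion_def ann_def smult_r_minus intro!: mono[of x, unfolded ann_def])
    show "x \<oplus>\<^bsub>M\<^esub> y \<in> torsion R \<tau> M" if "x \<in> torsion R \<tau> M" "y \<in> torsion R \<tau> M" for x y
    proof -
      have xy: "x \<in> carrier M" "y \<in> carrier M" and "\<tau> (ann R M x)" "\<tau> (ann R M y)"
        using that by (auto simp: torsion_def)
      then have "\<tau> (ann R M x \<inter> ann R M y)"
        using assms id xy unfolding ideal_filter_def by blast
      moreover have "ann R M x \<inter> ann R M y \<subseteq> ann R M (x \<oplus>\<^bsub>M\<^esub> y)"
        using xy by (auto simp: ann_def smult_r_distr)
      ultimately have "\<tau> (ann R M (x \<oplus>\<^bsub>M\<^esub> y))"
        using assms id xy R.i_intersect unfolding ideal_filter_def by (meson M.add.m_closed)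
      then show ?thesis using xy by (simp add: torsion_def)
    qed
    show "a \<odot>\<^bsub>M\<^esub> x \<in> torsion R \<tau> M" if "a \<in> carrier R" "x \<in> torsion R \<tau> M" for a x
    proof -
      have x: "x \<in> carrier M" "\<tau> (ann R M x)" using that by (auto simp: torsion_def)
      have "r \<odot>\<^bsub>M\<^esub> (a \<odot>\<^bsub>M\<^esub> x) = a \<odot>\<^bsub>M\<^esub> (r \<odot>\<^bsub>M\<^esub> x)" if "r \<in> carrier R" for r
        using that \<open>a \<in> carrier R\<close> x by (simp add: smult_assoc1[symmetric] m_comm)
      then have "ann R M x \<subseteq> ann R M (a \<odot>\<^bsub>M\<^esub> x)"
        using \<open>a \<in> carrier R\<close> by (auto simp: ann_def)
      then show ?thesis
        using mono[of x] x \<open>a \<in> carrier R\<close> by (simp add: torsion_def)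
    qed
  qed (auto simp: torsion_def)
qed

text \<open>
  The common form of weak fairness and weak large fairness; the filter is a parameter of its own,
  related to \<open>\<aa>\<close> only when it is instantiated.
\<close>

definition fair_wrt ::
  "'b itself \<Rightarrow> ('a, 'r) ring_scheme \<Rightarrow> 'a set \<Rightarrow> ('a set \<Rightarrow> bool) \<Rightarrow> bool" where
  "fair_wrt _ R \<aa> \<tau> \<longleftrightarrow>
    (\<forall>M :: ('a, 'b) module. module R M \<longrightarrow>
       rel_assassin R M (torsion R \<tau> M) = rel_assassin R M {\<zero>\<^bsub>M\<^esub>} - Var R \<aa>)"

definition small_filter :: "('a, 'r) ring_scheme \<Rightarrow> 'a set \<Rightarrow> 'a set \<Rightarrow> bool" where
  "small_filter R \<aa> J \<longleftrightarrow> (\<exists>n::nat. \<aa> [^]\<^bsub>ideals_set R\<^esub> n \<subseteq> J)"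

definition large_filter :: "('a, 'r) ring_scheme \<Rightarrow> 'a set \<Rightarrow> 'a set \<Rightarrow> bool" where
  "large_filter R \<aa> J \<longleftrightarrow> \<aa> \<subseteq> ideal_radical R J"

lemma small_torsion_eq: "small_torsion R \<aa> M = torsion R (small_filter R \<aa>) M"
  by (simp add: small_torsion_def torsion_def small_filter_def)

lemma large_torsion_eq: "large_torsion R \<aa> M = torsion R (large_filter R \<aa>) M"
  by (simp add: large_torsion_def torsion_def large_filter_def)

lemma ideals_pow_0: "\<aa> [^]\<^bsub>ideals_set R\<^esub> (0::nat) = carrier R"
  and ideals_pow_Suc: "\<aa> [^]\<^bsub>ideals_set R\<^esub> Suc n = (\<aa> [^]\<^bsub>ideals_set R\<^esub> n) \<cdot>\<^bsub>R\<^esub> \<aa>"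
  by (simp_all add: nat_pow_def ideals_set_def)

context ring begin

lemma ideal_ideals_pow:
  assumes "ideal \<aa> R"
  shows "ideal (\<aa> [^]\<^bsub>ideals_set R\<^esub> (n::nat)) R"
proof (induction n)
  case 0
  show ?case unfolding ideals_pow_0 by (rule oneideal)
next
  case (Suc n)
  then show ?case unfolding ideals_pow_Suc by (rule ideal_prod_is_ideal[OF _ assms])
qed

lemma ideals_pow_antimono:
  assumes "ideal \<aa> R" "m \<le> n"
  shows "\<aa> [^]\<^bsub>ideals_set R\<^esub> (n::nat) \<subseteq> \<aa> [^]\<^bsub>ideals_set R\<^esub> m"
  using assms(2)
proof (induction n rule: dec_induct)
  case (step n)
  then show ?case
    using ideal_prod_inter[OF ideal_ideals_pow[OF assms(1), of n] assms(1)]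
    unfolding ideals_pow_Suc by blast
qed simp

lemma ideal_filter_small:
  assumes "ideal \<aa> R"
  shows "ideal_filter R (small_filter R \<aa>)"
proof -
  have "small_filter R \<aa> (I \<inter> J)" if "small_filter R \<aa> I" "small_filter R \<aa> J" for I J
  proof -
    obtain m n where "\<aa> [^]\<^bsub>ideals_set R\<^esub> (m::nat) \<subseteq> I" "\<aa> [^]\<^bsub>ideals_set R\<^esub> (n::nat) \<subseteq> J"
      using \<open>small_filter R \<aa> I\<close> \<open>small_filter R \<aa> J\<close> by (auto simp: small_filter_def)
    then have "\<aa> [^]\<^bsub>ideals_set R\<^esub> (max m n) \<subseteq> I \<inter> J"
      using ideals_pow_antimono[OF assms, of m "max m n"] ideals_pow_antimono[OF assms, of n "max m n"]
      by auto
    then show ?thesis by (auto simp: small_filter_def)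
  qed
  moreover have "small_filter R \<aa> J" if "small_filter R \<aa> I" "I \<subseteq> J" for I J
    using that unfolding small_filter_def by blast
  moreover have "small_filter R \<aa> (carrier R)"
    unfolding small_filter_def using ideals_pow_0 by (metis order_refl)
  ultimately show ?thesis
    unfolding ideal_filter_def by blast
qed

lemma ideal_filter_large:
  assumes "\<aa> \<subseteq> carrier R"
  shows "ideal_filter R (large_filter R \<aa>)"
proof -
  have inter: "\<exists>n::nat. r [^] n \<in> I \<inter> J" if "ideal I R" "ideal J R" "r \<in> carrier R" "r [^] (m::nat) \<in> I" "r [^] (n::nat) \<in> J"
    for r I J m n
  proof (intro exI IntI)
    have "r [^] (m + n) = r [^] m \<otimes> r [^] n"
      using that by (simp add: nat_pow_mult)
    then show "r [^] (m + n) \<in> I" "r [^] (m + n) \<in> J"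
      using that by (simp_all add: ideal.I_l_closed ideal.I_r_closed del: nat_pow_mult)
  qed
  have "large_filter R \<aa> (I \<inter> J)" if "ideal I R" "ideal J R" "large_filter R \<aa> I" "large_filter R \<aa> J" for I J
  proof (unfold large_filter_def, rule subsetI)
    fix r assume "r \<in> \<aa>"
    then obtain m n :: nat where "r \<in> carrier R" "r [^] m \<in> I" "r [^] n \<in> J"
      using \<open>large_filter R \<aa> I\<close> \<open>large_filter R \<aa> J\<close> by (fastforce simp: large_filter_def ideal_radical_def)
    then show "r \<in> ideal_radical R (I \<inter> J)"
      using inter[OF \<open>ideal I R\<close> \<open>ideal J R\<close>, of r m n] by (simp add: ideal_radical_def)
  qed
  moreover have "large_filter R \<aa> J" if "large_filter R \<aa> I" "I \<subseteq> J" for I J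
    using that unfolding large_filter_def ideal_radical_def by blast
  moreover have "large_filter R \<aa> (carrier R)"
    using assms by (auto simp: large_filter_def ideal_radical_def)
  ultimately show ?thesis
    unfolding ideal_filter_def by blast
qed

end

lemma weakly_fair_iff:
  assumes "ring R" "ideal \<aa> R"
  shows "weakly_fair TYPE('b) R \<aa> \<longleftrightarrow> fair_wrt TYPE('b) R \<aa> (small_filter R \<aa>)"
proof -
  note filter = ring.ideal_filter_small[OF assms]
  have "weak_assassin R (quot_module M (torsion R (small_filter R \<aa>) M)) =
      rel_assassin R M (torsion R (small_filter R \<aa>) M)" if "module R M" for M :: "('a, 'b) module"
    by (rule module.weak_assassin_quot[OF that module.submodule_torsion[OF that filter]])
  then show ?thesis
    by (simp add: weakly_fair_def fair_wrt_def small_torsion_eq weak_assassin_eq[of R "_ :: ('a, 'b) module"])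
qed

lemma weakly_large_fair_iff:
  assumes "ring R" "ideal \<aa> R"
  shows "weakly_large_fair TYPE('b) R \<aa> \<longleftrightarrow> fair_wrt TYPE('b) R \<aa> (large_filter R \<aa>)"
proof -
  have "\<aa> \<subseteq> carrier R"
    using assms(2) by (simp add: ideal.axioms additive_subgroup.a_subset)
  note filter = ring.ideal_filter_large[OF assms(1) this]
  have "weak_assassin R (quot_module M (torsion R (large_filter R \<aa>) M)) =
      rel_assassin R M (torsion R (large_filter R \<aa>) M)" if "module R M" for M :: "('a, 'b) module"
    by (rule module.weak_assassin_quot[OF that module.submodule_torsion[OF that filter]])
  then show ?thesis
    by (simp add: weakly_large_fair_def fair_wrt_def large_torsion_eq weak_assassin_eq[of R "_ :: ('a, 'b) module"])
qed

section \<open>Ideals and primes of the localised ring\<close>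

context localisation begin

definition contraction :: "('a \<times> 'a) set set \<Rightarrow> 'a set" where
  "contraction J = {r \<in> carrier R. \<phi> r \<in> J}"

definition restrict_scalars :: "(('a \<times> 'a) set, 'c) module \<Rightarrow> ('a, 'c) module" where
  "restrict_scalars M = \<lparr>carrier = carrier M, mult = undefined, one = undefined, zero = \<zero>\<^bsub>M\<^esub>, add = add M,
     smult = (\<lambda>r x. \<phi> r \<odot>\<^bsub>M\<^esub> x)\<rparr>"

lemma ring_frac_closed [simp]: "r \<in> carrier R \<Longrightarrow> s \<in> T \<Longrightarrow> ring_frac R S r s \<in> carrier A"
  by (simp add: loc_ring_simps)

lemma loc_ringE:
  assumes "a \<in> carrier A"
  obtains r s where "r \<in> carrier R" "s \<in> T" "a = ring_frac R S r s"
  using assms by (auto simp: loc_ring_simps elim!: loc_carrierE)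

lemma ring_frac_mult:
  assumes "r \<in> carrier R" "r' \<in> carrier R" "s \<in> T" "t \<in> T"
  shows "ring_frac R S r s \<otimes>\<^bsub>A\<^esub> ring_frac R S r' t = ring_frac R S (r \<otimes> r') (s \<otimes> t)"
  using frac_smult[OF module_self, of r r' s t] assms by (simp add: loc_ring_simps)

lemma ring_frac_add:
  assumes "r \<in> carrier R" "r' \<in> carrier R" "s \<in> T" "t \<in> T"
  shows "ring_frac R S r s \<oplus>\<^bsub>A\<^esub> ring_frac R S r' t = ring_frac R S (t \<otimes> r \<oplus> s \<otimes> r') (s \<otimes> t)"
  using frac_add[OF module_self, of r r' s t] assms by (simp add: loc_ring_simps)

lemma ring_frac_eq_iff:
  assumes "r \<in> carrier R" "r' \<in> carrier R" "s \<in> T" "t \<in> T"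
  shows "ring_frac R S r s = ring_frac R S r' t \<longleftrightarrow> (\<exists>u\<in>T. (u \<otimes> t) \<otimes> r = (u \<otimes> s) \<otimes> r')"
  using frac_eq_iff[OF module_self, of r r' s t] assms by simp

lemma mem_ideal_iff:
  assumes "ideal J A" "r \<in> carrier R" "s \<in> T"
  shows "ring_frac R S r s \<in> J \<longleftrightarrow> r \<in> contraction J"
proof -
  interpret J: ideal J A by fact
  have 1: "\<phi> r = \<phi> s \<otimes>\<^bsub>A\<^esub> ring_frac R S r s"
    using assms by (simp add: ring_frac_mult ring_frac_eq_iff m_ac) (use one_T in blast)
  have 2: "ring_frac R S r s = ring_frac R S \<one> s \<otimes>\<^bsub>A\<^esub> \<phi> r"
    using assms by (simp add: ring_frac_mult)
  show ?thesis
  proof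
    assume "ring_frac R S r s \<in> J"
    then have "\<phi> r \<in> J" unfolding 1 using assms by (intro J.I_l_closed) simp_all
    then show "r \<in> contraction J" using assms by (simp add: contraction_def)
  next
    assume "r \<in> contraction J"
    then show "ring_frac R S r s \<in> J" unfolding 2 using assms
      by (intro J.I_l_closed) (simp_all add: contraction_def)
  qed
qed

lemma ideal_contr:
  assumes "ideal J A"
  shows "ideal (contraction J) R"
proof -
  interpret J: ideal J A by fact
  have mult: "r \<otimes> a \<in> contraction J" if "a \<in> contraction J" "r \<in> carrier R" for a r
    using J.I_l_closed[of "\<phi> a" "\<phi> r"] that by (simp add: contraction_def ring_frac_mult)
  have add: "a \<oplus> b \<in> contraction J" if "a \<in> contraction J" "b \<in> contraction J" for a b
  proof -
    have "\<phi> (a \<oplus> b) = \<phi> a \<oplus>\<^bsub>A\<^esub> \<phi> b"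
      using that by (simp add: contraction_def ring_frac_add)
    then show ?thesis using that by (simp add: contraction_def)
  qed
  have "\<phi> \<zero> = \<zero>\<^bsub>A\<^esub>"
    by (simp add: loc_ring_simps(4) loc_zero)
  then have zero: "\<zero> \<in> contraction J"
    by (simp add: contraction_def)
  show ?thesis
  proof (rule idealI[OF ring_axioms])
    show "subgroup (contraction J) (add_monoid R)"
    proof (rule add.subgroupI)
      show "\<ominus> a \<in> contraction J" if "a \<in> contraction J" for a
        using mult[OF that, of "\<ominus> \<one>"] that by (simp add: contraction_def l_minus)
    qed (use zero add in \<open>auto simp: contraction_def\<close>)
    show "a \<otimes> r \<in> contraction J" if "a \<in> contraction J" "r \<in> carrier R" for a r
      using mult[OF that] that by (simp add: contraction_def m_comm)
  qed (rule mult)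
qed

lemma ideal_le_iff:
  assumes "ideal J A" "ideal K A"
  shows "J \<subseteq> K \<longleftrightarrow> contraction J \<subseteq> contraction K"
proof
  show "J \<subseteq> K" if "contraction J \<subseteq> contraction K"
  proof
    fix a assume "a \<in> J"
    moreover then obtain r s where "r \<in> carrier R" "s \<in> T" "a = ring_frac R S r s"
      using loc_ringE ideal.Icarr[OF assms(1)] by metis
    ultimately show "a \<in> K" using that mem_ideal_iff[OF assms(1)] mem_ideal_iff[OF assms(2)] by blast
  qed
qed (auto simp: contraction_def)

lemma extI: "x \<in> I \<Longrightarrow> s \<in> T \<Longrightarrow> ring_frac R S x s \<in> ext I"
  unfolding loc_ideal_def by blast

lemma mem_ext_iff:
  assumes "ideal I R" "r \<in> carrier R" "s \<in> T"
  shows "ring_frac R S r s \<in> ext I \<longleftrightarrow> (\<exists>u\<in>T. u \<otimes> r \<in> I)"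
proof -
  interpret I: ideal I R by fact
  show ?thesis
  proof
    assume "ring_frac R S r s \<in> ext I"
    then obtain x t where x: "x \<in> I" "t \<in> T" "ring_frac R S r s = ring_frac R S x t"
      by (auto simp: loc_ideal_def)
    then obtain u where u: "u \<in> T" "(u \<otimes> t) \<otimes> r = (u \<otimes> s) \<otimes> x"
      using assms I.Icarr by (auto simp: ring_frac_eq_iff)
    then have "(u \<otimes> t) \<otimes> r \<in> I" using x assms by (simp add: I.I_l_closed)
    then show "\<exists>u\<in>T. u \<otimes> r \<in> I" using u(1) x(2) mult_T by blast
  next
    assume "\<exists>u\<in>T. u \<otimes> r \<in> I"
    then obtain u where u: "u \<in> T" "u \<otimes> r \<in> I" by blast
    have "ring_frac R S r s = ring_frac R S (u \<otimes> r) (u \<otimes> s)"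
      using u assms by (simp add: ring_frac_eq_iff m_ac) (use one_T in blast)
    then show "ring_frac R S r s \<in> ext I"
      using u assms by (simp add: extI)
  qed
qed

lemma contr_ext: "ideal I R \<Longrightarrow> contraction (ext I) = {r \<in> carrier R. \<exists>u\<in>T. u \<otimes> r \<in> I}"
  by (auto simp: contraction_def mem_ext_iff)

lemma ideal_ext:
  assumes "ideal I R"
  shows "ideal (ext I) A"
proof -
  interpret I: ideal I R by fact
  interpret A: cring A by (rule cring_loc)
  have sub: "ext I \<subseteq> carrier A" using I.Icarr by (auto simp: loc_ideal_def)
  have mult: "x \<otimes>\<^bsub>A\<^esub> a \<in> ext I" if "a \<in> ext I" "x \<in> carrier A" for a x
  proof -
    obtain i s where a: "i \<in> I" "s \<in> T" "a = ring_frac R S i s"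
      using \<open>a \<in> ext I\<close> by (auto simp: loc_ideal_def)
    obtain r t where x: "r \<in> carrier R" "t \<in> T" "x = ring_frac R S r t"
      using \<open>x \<in> carrier A\<close> by (rule loc_ringE)
    have "x \<otimes>\<^bsub>A\<^esub> a = ring_frac R S (r \<otimes> i) (t \<otimes> s)"
      using a x I.Icarr by (simp add: ring_frac_mult)
    then show ?thesis
      using a x by (simp add: I.I_l_closed extI)
  qed
  have add: "a \<oplus>\<^bsub>A\<^esub> b \<in> ext I" if "a \<in> ext I" "b \<in> ext I" for a b
  proof -
    obtain i s j t where a: "i \<in> I" "s \<in> T" "a = ring_frac R S i s"
      and b: "j \<in> I" "t \<in> T" "b = ring_frac R S j t"
      using \<open>a \<in> ext I\<close> \<open>b \<in> ext I\<close> by (auto simp: loc_ideal_def)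
    have "a \<oplus>\<^bsub>A\<^esub> b = ring_frac R S (t \<otimes> i \<oplus> s \<otimes> j) (s \<otimes> t)"
      using a b I.Icarr by (simp add: ring_frac_add)
    moreover have "t \<otimes> i \<oplus> s \<otimes> j \<in> I" using a b by (simp add: I.I_l_closed)
    ultimately show ?thesis
      using a b by (simp add: extI)
  qed
  show ?thesis
  proof (rule idealI[OF A.ring_axioms])
    show "subgroup (ext I) (add_monoid A)"
    proof (rule A.add.subgroupI[OF sub])
      show "ext I \<noteq> {}" using extI[OF I.zero_closed one_T] by blast
      show "\<ominus>\<^bsub>A\<^esub> a \<in> ext I" if "a \<in> ext I" for a
        using mult[OF that, of "\<ominus>\<^bsub>A\<^esub> \<one>\<^bsub>A\<^esub>"] that sub by (auto simp: A.l_minus)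
    qed (rule add)
    show "a \<otimes>\<^bsub>A\<^esub> x \<in> ext I" if "a \<in> ext I" "x \<in> carrier A" for a x
      using mult[OF that] that sub by (simp add: A.m_comm subset_iff)
  qed (rule mult)
qed

lemma ext_le_iff:
  assumes "ideal I R" "ideal J A"
  shows "ext I \<subseteq> J \<longleftrightarrow> I \<subseteq> contraction J"
proof
  interpret I: ideal I R by fact
  show "I \<subseteq> contraction J" if "ext I \<subseteq> J"
  proof
    fix i assume "i \<in> I"
    moreover then have "\<phi> i \<in> ext I" by (simp add: extI)
    ultimately show "i \<in> contraction J" using that I.Icarr by (auto simp: contraction_def)
  qed
  show "ext I \<subseteq> J" if "I \<subseteq> contraction J"
    using that mem_ideal_iff[OF assms(2)] I.Icarr by (auto simp: loc_ideal_def)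
qed

lemma prime_contr:
  assumes "primeideal P A"
  shows "primeideal (contraction P) R" "contraction P \<inter> T = {}"
proof -
  interpret P: primeideal P A by fact
  interpret c: ideal "contraction P" R by (rule ideal_contr[OF P.ideal_axioms])
  have "contraction P \<inter> T = {}"
  proof (rule ccontr)
    assume "contraction P \<inter> T \<noteq> {}"
    then obtain s where s: "s \<in> contraction P" "s \<in> T" by blast
    then have "ring_frac R S s s \<in> P" using mem_ideal_iff[OF P.ideal_axioms] by simp
    moreover have "ring_frac R S s s = \<one>\<^bsub>A\<^esub>"
      using s by (simp add: loc_ring_simps(5) ring_frac_eq_iff) (use one_T in blast)
    ultimately show False using P.one_imp_carrier P.I_notcarr by simp
  qed
  then show "contraction P \<inter> T = {}" .
  show "primeideal (contraction P) R"
  proof (rule primeidealI[OF c.ideal_axioms cring_axioms])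
    show "carrier R \<noteq> contraction P" using \<open>contraction P \<inter> T = {}\<close> one_T one_closed by blast
    fix a b assume ab: "a \<in> carrier R" "b \<in> carrier R" "a \<otimes> b \<in> contraction P"
    have closed: "\<phi> a \<in> carrier A" "\<phi> b \<in> carrier A" using ab by simp_all
    have "\<phi> a \<otimes>\<^bsub>A\<^esub> \<phi> b = \<phi> (a \<otimes> b)" using ab(1,2) by (simp add: ring_frac_mult)
    then have "\<phi> a \<otimes>\<^bsub>A\<^esub> \<phi> b \<in> P" using ab(3) unfolding contraction_def by simp
    then have "\<phi> a \<in> P \<or> \<phi> b \<in> P" by (rule P.I_prime[OF closed])
    then show "a \<in> contraction P \<or> b \<in> contraction P" unfolding contraction_def using ab(1,2) by blast
  qed
qed

lemma contr_ext_prime: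
  assumes "primeideal \<pp> R" "\<pp> \<inter> T = {}"
  shows "contraction (ext \<pp>) = \<pp>"
proof -
  interpret p: primeideal \<pp> R by fact
  have "u \<otimes> r \<in> \<pp> \<longleftrightarrow> r \<in> \<pp>" if "u \<in> T" "r \<in> carrier R" for u r
    using that p.I_prime[of u r] assms(2) p.I_l_closed by auto
  then show ?thesis
    unfolding contr_ext[OF p.ideal_axioms] using one_T p.Icarr by blast
qed

lemma prime_ext:
  assumes "primeideal \<pp> R" "\<pp> \<inter> T = {}"
  shows "primeideal (ext \<pp>) A"
proof -
  interpret p: primeideal \<pp> R by fact
  note ce = contr_ext_prime[OF assms]
  note id = ideal_ext[OF p.ideal_axioms]
  show ?thesis
  proof (rule primeidealI[OF id cring_loc])
    have "\<one> \<notin> \<pp>" using assms(2) one_T by blast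
    then have "\<phi> \<one> \<notin> ext \<pp>" using mem_ideal_iff[OF id, of \<one> \<one>] ce by simp
    then show "carrier A \<noteq> ext \<pp>" by (metis ring_frac_closed one_closed one_T)
    fix a b assume ab: "a \<in> carrier A" "b \<in> carrier A" "a \<otimes>\<^bsub>A\<^esub> b \<in> ext \<pp>"
    then obtain r s r' t where *: "r \<in> carrier R" "s \<in> T" "a = ring_frac R S r s"
      "r' \<in> carrier R" "t \<in> T" "b = ring_frac R S r' t"
      by (meson loc_ringE)
    then have "r \<otimes> r' \<in> \<pp>"
      using ab(3) by (simp add: ring_frac_mult mem_ideal_iff[OF id] ce)
    then show "a \<in> ext \<pp> \<or> b \<in> ext \<pp>"
      using * p.I_prime[of r r'] by (simp add: mem_ideal_iff[OF id] ce)
  qed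
qed

text \<open>
  A prime of \<open>R\<close> below a contracted prime avoids the denominators, hence is itself contracted. So the
  primes competing for minimality correspond on the two sides.
\<close>

lemma min_primes_contr:
  assumes "ideal J A" "primeideal P A"
  shows "contraction P \<in> min_primes R (contraction J) \<longleftrightarrow> P \<in> min_primes A J"
proof
  note idP = primeideal.axioms(1)
  assume L: "contraction P \<in> min_primes R (contraction J)"
  have "J \<subseteq> P"
    using L by (simp add: min_primes_def Var_def ideal_le_iff[OF assms(1) idP[OF assms(2)]])
  moreover have "Q = P" if Q: "primeideal Q A" "J \<subseteq> Q" "Q \<subseteq> P" for Q
  proof -
    have "contraction J \<subseteq> contraction Q" "contraction Q \<subseteq> contraction P" using Q by (auto simp: contraction_def)
    then have "contraction Q = contraction P"
      using L prime_contr(1)[OF Q(1)] by (auto simp: min_primes_def Var_def)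
    then have "P \<subseteq> Q" using ideal_le_iff[OF idP[OF assms(2)] idP[OF Q(1)]] by simp
    then show ?thesis using Q(3) by simp
  qed
  ultimately show "P \<in> min_primes A J"
    using assms(2) by (auto simp: min_primes_def Var_def)
next
  assume L: "P \<in> min_primes A J"
  have "contraction J \<subseteq> contraction P"
    using L by (auto simp: min_primes_def Var_def contraction_def)
  moreover have "\<qq> = contraction P" if q: "primeideal \<qq> R" "contraction J \<subseteq> \<qq>" "\<qq> \<subseteq> contraction P" for \<qq>
  proof -
    have "\<qq> \<inter> T = {}" using q(3) prime_contr(2)[OF assms(2)] by blast
    note * = prime_ext[OF q(1) this] contr_ext_prime[OF q(1) this]
    have "ext \<qq> \<subseteq> P" "J \<subseteq> ext \<qq>"
      using q(2,3) assms ideal_le_iff *  primeideal.axioms(1) by (metis)+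
    then have "ext \<qq> = P" using L * by (simp add: min_primes_def Var_def)
    then show ?thesis using * by simp
  qed
  ultimately show "contraction P \<in> min_primes R (contraction J)"
    using prime_contr[OF assms(2)] by (auto simp: min_primes_def Var_def)
qed

section \<open>Restriction of scalars\<close>

lemma module_restr:
  assumes "module A M"
  shows "module R (restrict_scalars M)"
proof -
  interpret M: module A M by fact
  have 1: "\<phi> (r \<oplus> r') = \<phi> r \<oplus>\<^bsub>A\<^esub> \<phi> r'" "\<phi> (r \<otimes> r') = \<phi> r \<otimes>\<^bsub>A\<^esub> \<phi> r'"
    if "r \<in> carrier R" "r' \<in> carrier R" for r r'
    using that by (simp_all add: ring_frac_mult ring_frac_add)
  have 2: "\<phi> \<one> = \<one>\<^bsub>A\<^esub>" by (simp add: loc_ring_simps(5))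
  show ?thesis
  proof (rule moduleI[OF cring_axioms])
    show "abelian_group (restrict_scalars M)"
      by (rule abelian_groupI) (use abelian_groupE[OF M.abelian_group_axioms] in \<open>simp_all add: restrict_scalars_def\<close>)
  qed (simp_all add: restrict_scalars_def 1 2 M.smult_l_distr M.smult_r_distr M.smult_assoc1)
qed

lemma colon_restr: "colon R (restrict_scalars M) G x = contraction (colon A M G x)"
  by (auto simp: colon_def contraction_def restrict_scalars_def)

text \<open>
  The same element \<open>x\<close> witnesses both sides, because \<open>(G : x)\<close> over \<open>R\<close> is a contraction.
\<close>

lemma rel_assassin_restr:
  assumes "module A M" "submodule G A M" "primeideal P A"
  shows "contraction P \<in> rel_assassin R (restrict_scalars M) G \<longleftrightarrow> P \<in> rel_assassin A M G"
proof -
  interpret M: module A M by fact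
  have "carrier (restrict_scalars M) = carrier M" by (simp add: restrict_scalars_def)
  then show ?thesis
    using assms prime_contr[OF assms(3)]
    by (simp add: rel_assassin_def colon_restr min_primes_contr M.ideal_colon)
qed

lemma torsion_restr:
  assumes "module A M" and compat: "\<And>J. ideal J A \<Longrightarrow> \<tau>' J \<longleftrightarrow> \<tau> (contraction J)"
  shows "torsion R \<tau> (restrict_scalars M) = torsion A \<tau>' M"
proof -
  interpret M: module A M by fact
  have "\<tau>' (ann A M x) \<longleftrightarrow> \<tau> (ann R (restrict_scalars M) x)" if "x \<in> carrier M" for x
  proof -
    have "ann R (restrict_scalars M) x = contraction (ann A M x)"
      unfolding ann_eq_colon colon_restr[symmetric] by (simp add: restrict_scalars_def)
    then show ?thesis
      using compat M.ideal_colon[OF M.submodule_zero that] by (simp add: ann_eq_colon)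
  qed
  then show ?thesis
    by (auto simp: torsion_def restrict_scalars_def)
qed

text \<open>
  The hypothesis \<open>compat\<close> makes torsion over \<open>R\<close> and over \<open>S\<^sup>-\<^sup>1R\<close> the same subset of an
  \<open>S\<^sup>-\<^sup>1R\<close>-module, so the claim is the given identity for the restricted module, evaluated at
  contracted primes.
\<close>

theorem fair_wrt_localisation:
  assumes "ideal \<aa> R" "ideal_filter A \<tau>'" and compat: "\<And>J. ideal J A \<Longrightarrow> \<tau>' J \<longleftrightarrow> \<tau> (contraction J)"
    and fair: "fair_wrt TYPE('c) R \<aa> \<tau>"
  shows "fair_wrt TYPE('c) A (ext \<aa>) \<tau>'"
  unfolding fair_wrt_def
proof (intro allI impI)
  fix M :: "(('a \<times> 'a) set, 'c) module"
  assume M: "module A M"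
  interpret M: module A M by fact
  have "P \<in> rel_assassin A M (torsion A \<tau>' M) \<longleftrightarrow> P \<in> rel_assassin A M {\<zero>\<^bsub>M\<^esub>} - Var A (ext \<aa>)" for P
  proof (cases "primeideal P A")
    case True
    have "rel_assassin R (restrict_scalars M) (torsion R \<tau> (restrict_scalars M)) =
        rel_assassin R (restrict_scalars M) {\<zero>\<^bsub>restrict_scalars M\<^esub>} - Var R \<aa>"
      using fair module_restr[OF M] unfolding fair_wrt_def by blast
    moreover have "torsion R \<tau> (restrict_scalars M) = torsion A \<tau>' M"
      by (rule torsion_restr[OF M]) (rule compat)
    moreover have "\<zero>\<^bsub>restrict_scalars M\<^esub> = \<zero>\<^bsub>M\<^esub>" by (simp add: restrict_scalars_def)
    moreover have "contraction P \<in> Var R \<aa> \<longleftrightarrow> P \<in> Var A (ext \<aa>)"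
      using True prime_contr[OF True] ext_le_iff[OF assms(1) primeideal.axioms(1)[OF True]]
      by (simp add: Var_def)
    ultimately show ?thesis
      using rel_assassin_restr[OF M _ True] M.submodule_zero M.submodule_torsion[OF assms(2)] by auto
  qed (simp add: rel_assassin_def)
  then show "rel_assassin A M (torsion A \<tau>' M) = rel_assassin A M {\<zero>\<^bsub>M\<^esub>} - Var A (ext \<aa>)"
    by blast
qed

text \<open>
  This lemma and the next give the two inclusions behind \<open>(S\<^sup>-\<^sup>1\<aa>)\<^sup>n = S\<^sup>-\<^sup>1(\<aa>\<^sup>n)\<close>, in the form needed to
  compare containment in an ideal with containment in its contraction.
\<close>

lemma phi_ideals_pow:
  assumes "ideal \<aa> R" "r \<in> \<aa> [^]\<^bsub>ideals_set R\<^esub> (n::nat)"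
  shows "\<phi> r \<in> ext \<aa> [^]\<^bsub>ideals_set A\<^esub> n"
  using assms(2)
proof (induction n arbitrary: r)
  case 0
  then show ?case by (simp only: ideals_pow_0 ring_frac_closed one_T)
next
  case (Suc n)
  interpret a: ideal \<aa> R by fact
  have sub: "\<aa> [^]\<^bsub>ideals_set R\<^esub> n \<subseteq> carrier R"
    using ideal_ideals_pow[OF assms(1)] by (meson ideal.Icarr subsetI)
  from Suc.prems show ?case unfolding ideals_pow_Suc
  proof (induction rule: ideal_prod.induct)
    case (prod i j)
    moreover have "\<phi> j \<in> ext \<aa>" using prod(2) by (simp add: extI)
    ultimately have "\<phi> i \<otimes>\<^bsub>A\<^esub> \<phi> j \<in> (ext \<aa> [^]\<^bsub>ideals_set A\<^esub> n) \<cdot>\<^bsub>A\<^esub> ext \<aa>"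
      using Suc.IH by (intro ideal_prod.prod)
    then show ?case using prod sub a.Icarr by (simp add: ring_frac_mult subset_iff)
  next
    case (sum s1 s2)
    have "s1 \<in> carrier R" "s2 \<in> carrier R"
      using sum.hyps ideal_prod_in_carrier[OF ideal_ideals_pow[OF assms(1)] assms(1)] by blast+
    then show ?case using ideal_prod.sum[OF sum.IH] by (simp add: ring_frac_add)
  qed
qed

lemma ideals_pow_ext_le:
  assumes "ideal \<aa> R"
  shows "ext \<aa> [^]\<^bsub>ideals_set A\<^esub> (n::nat) \<subseteq> ext (\<aa> [^]\<^bsub>ideals_set R\<^esub> n)"
proof (induction n)
  case 0
  show ?case unfolding ideals_pow_0 by (auto simp: loc_ideal_def elim!: loc_ringE)
next
  case (Suc n)
  interpret a: ideal \<aa> R by fact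
  interpret e: ideal "ext (\<aa> [^]\<^bsub>ideals_set R\<^esub> Suc n)" A
    by (rule ideal_ext[OF ideal_ideals_pow[OF assms]])
  have sub: "\<aa> [^]\<^bsub>ideals_set R\<^esub> n \<subseteq> carrier R"
    using ideal_ideals_pow[OF assms(1)] by (meson ideal.Icarr subsetI)
  show ?case
  proof
    fix a assume "a \<in> ext \<aa> [^]\<^bsub>ideals_set A\<^esub> Suc n"
    then show "a \<in> ext (\<aa> [^]\<^bsub>ideals_set R\<^esub> Suc n)"
      unfolding ideals_pow_Suc[of A "ext \<aa>"]
    proof (induction rule: ideal_prod.induct)
      case (prod i j)
      then obtain r s r' t where *: "r \<in> \<aa> [^]\<^bsub>ideals_set R\<^esub> n" "s \<in> T" "i = ring_frac R S r s"
        "r' \<in> \<aa>" "t \<in> T" "j = ring_frac R S r' t"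
        using Suc.IH unfolding loc_ideal_def by blast
      then have "i \<otimes>\<^bsub>A\<^esub> j = ring_frac R S (r \<otimes> r') (s \<otimes> t)"
        using sub a.Icarr by (simp add: ring_frac_mult subset_iff)
      moreover have "r \<otimes> r' \<in> \<aa> [^]\<^bsub>ideals_set R\<^esub> Suc n"
        unfolding ideals_pow_Suc using * by (intro ideal_prod.prod)
      ultimately show ?case using * by (simp add: extI)
    qed (rule additive_subgroup.a_closed[OF e.is_additive_subgroup])
  qed
qed

lemma small_filter_ext:
  assumes "ideal \<aa> R" "ideal J A"
  shows "small_filter A (ext \<aa>) J \<longleftrightarrow> small_filter R \<aa> (contraction J)"
proof -
  have "ext \<aa> [^]\<^bsub>ideals_set A\<^esub> n \<subseteq> J \<longleftrightarrow> \<aa> [^]\<^bsub>ideals_set R\<^esub> n \<subseteq> contraction J" for n :: nat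
  proof
    assume "ext \<aa> [^]\<^bsub>ideals_set A\<^esub> n \<subseteq> J"
    then show "\<aa> [^]\<^bsub>ideals_set R\<^esub> n \<subseteq> contraction J"
      using phi_ideals_pow[OF assms(1)] ideal.Icarr[OF ideal_ideals_pow[OF assms(1)]]
      by (auto simp: contraction_def)
  next
    assume "\<aa> [^]\<^bsub>ideals_set R\<^esub> n \<subseteq> contraction J"
    then show "ext \<aa> [^]\<^bsub>ideals_set A\<^esub> n \<subseteq> J"
      using ideals_pow_ext_le[OF assms(1)] ext_le_iff[OF ideal_ideals_pow[OF assms(1)] assms(2)] by blast
  qed
  then show ?thesis by (simp add: small_filter_def)
qed

lemma pow_T: "s \<in> T \<Longrightarrow> s [^] (n::nat) \<in> T"
  by (induction n) auto

lemma large_filter_ext: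
  assumes "ideal \<aa> R" "ideal J A"
  shows "large_filter A (ext \<aa>) J \<longleftrightarrow> large_filter R \<aa> (contraction J)"
proof -
  interpret a: ideal \<aa> R by fact
  have pow: "ring_frac R S r s [^]\<^bsub>A\<^esub> n = ring_frac R S (r [^] n) (s [^] n)"
    if "r \<in> carrier R" "s \<in> T" for r s and n :: nat
    using that by (induction n) (simp_all add: nat_pow_def loc_ring_simps(5)
        ring_frac_mult[unfolded nat_pow_def] pow_T[unfolded nat_pow_def]
        nat_pow_closed[unfolded nat_pow_def])
  have "ring_frac R S r s \<in> ideal_radical A J \<longleftrightarrow> r \<in> ideal_radical R (contraction J)"
    if "r \<in> carrier R" "s \<in> T" for r s
    using that by (simp add: ideal_radical_def pow mem_ideal_iff[OF assms(2)] pow_T)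
  then show ?thesis
    using a.Icarr one_T unfolding large_filter_def loc_ideal_def by blast
qed

end

section \<open>Transport of structure\<close>

definition transport :: "('b \<Rightarrow> 'c) \<Rightarrow> ('a, 'b, 'm) module_scheme \<Rightarrow> ('a, 'c) module" where
  "transport f M =
    \<lparr>carrier = f ` carrier M, mult = undefined, one = undefined, zero = f \<zero>\<^bsub>M\<^esub>,
     add = (\<lambda>x y. f (inv_into (carrier M) f x \<oplus>\<^bsub>M\<^esub> inv_into (carrier M) f y)),
     smult = (\<lambda>r x. f (r \<odot>\<^bsub>M\<^esub> inv_into (carrier M) f x))\<rparr>"

context module begin

lemma transport_add_smult:
  assumes "inj_on f (carrier M)" "x \<in> carrier M"
  shows "y \<in> carrier M \<Longrightarrow> f x \<oplus>\<^bsub>transport f M\<^esub> f y = f (x \<oplus>\<^bsub>M\<^esub> y)"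
    and "r \<odot>\<^bsub>transport f M\<^esub> f x = f (r \<odot>\<^bsub>M\<^esub> x)"
  using assms by (simp_all add: transport_def)

lemma module_transport:
  assumes inj: "inj_on f (carrier M)"
  shows "module R (transport f M)"
proof -
  have carrier: "carrier (transport f M) = f ` carrier M" and zero: "\<zero>\<^bsub>transport f M\<^esub> = f \<zero>\<^bsub>M\<^esub>"
    by (simp_all add: transport_def)
  note [simp] = transport_add_smult[OF inj]
  show ?thesis
  proof (rule moduleI[OF R.cring_axioms])
    show "abelian_group (transport f M)"
    proof (rule abelian_groupI)
      fix X Y Z
      assume "X \<in> carrier (transport f M)" "Y \<in> carrier (transport f M)" "Z \<in> carrier (transport f M)"
      then obtain x y z where "X = f x" "Y = f y" "Z = f z"
        and *: "x \<in> carrier M" "y \<in> carrier M" "z \<in> carrier M"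
        by (auto simp: carrier)
      then show "X \<oplus>\<^bsub>transport f M\<^esub> Y \<oplus>\<^bsub>transport f M\<^esub> Z = X \<oplus>\<^bsub>transport f M\<^esub> (Y \<oplus>\<^bsub>transport f M\<^esub> Z)"
        by (simp add: M.a_assoc)
    next
      fix X Y assume "X \<in> carrier (transport f M)" "Y \<in> carrier (transport f M)"
      then obtain x y where eqs: "X = f x" "Y = f y" and *: "x \<in> carrier M" "y \<in> carrier M"
        by (auto simp: carrier)
      show "X \<oplus>\<^bsub>transport f M\<^esub> Y \<in> carrier (transport f M)"
        using * by (simp add: eqs carrier)
      show "X \<oplus>\<^bsub>transport f M\<^esub> Y = Y \<oplus>\<^bsub>transport f M\<^esub> X"
        using * by (simp add: eqs M.a_comm)
      show "\<zero>\<^bsub>transport f M\<^esub> \<oplus>\<^bsub>transport f M\<^esub> X = X"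
        using * by (simp add: eqs zero)
      show "\<exists>Y\<in>carrier (transport f M). Y \<oplus>\<^bsub>transport f M\<^esub> X = \<zero>\<^bsub>transport f M\<^esub>"
        using * by (intro bexI[of _ "f (\<ominus>\<^bsub>M\<^esub> x)"]) (simp_all add: eqs carrier zero M.l_neg)
    qed (simp add: carrier zero)
  next
    fix a b X Y
    assume ab: "a \<in> carrier R" "b \<in> carrier R"
      and "X \<in> carrier (transport f M)" "Y \<in> carrier (transport f M)"
    then obtain x y where eqs: "X = f x" "Y = f y" and *: "x \<in> carrier M" "y \<in> carrier M"
      by (auto simp: carrier)
    show "a \<odot>\<^bsub>transport f M\<^esub> (X \<oplus>\<^bsub>transport f M\<^esub> Y) = a \<odot>\<^bsub>transport f M\<^esub> X \<oplus>\<^bsub>transport f M\<^esub> a \<odot>\<^bsub>transport f M\<^esub> Y"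
      using ab * by (simp add: eqs smult_r_distr)
  qed (use smult_l_distr smult_assoc1 in \<open>auto simp: carrier\<close>)
qed

lemma colon_transport:
  assumes inj: "inj_on f (carrier M)" and "G \<subseteq> carrier M" "x \<in> carrier M"
  shows "colon R (transport f M) (f ` G) (f x) = colon R M G x"
proof -
  have "f y \<in> f ` G \<longleftrightarrow> y \<in> G" if "y \<in> carrier M" for y
    using inj_on_image_mem_iff[OF inj that assms(2)] .
  then show ?thesis
    using assms(3) by (auto simp: colon_def transport_add_smult[OF inj])
qed

lemma rel_assassin_transport:
  assumes "inj_on f (carrier M)" "G \<subseteq> carrier M"
  shows "rel_assassin R (transport f M) (f ` G) = rel_assassin R M G"
proof -
  have "carrier (transport f M) = f ` carrier M" by (simp add: transport_def)
  then show ?thesis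
    using colon_transport[OF assms] by (simp add: rel_assassin_def)
qed

lemma torsion_transport:
  assumes "inj_on f (carrier M)"
  shows "torsion R \<tau> (transport f M) = f ` torsion R \<tau> M"
proof -
  have carrier: "carrier (transport f M) = f ` carrier M" and zero: "\<zero>\<^bsub>transport f M\<^esub> = f \<zero>\<^bsub>M\<^esub>"
    by (simp_all add: transport_def)
  have "ann R (transport f M) (f x) = ann R M x" if "x \<in> carrier M" for x
    using colon_transport[OF assms, of "{\<zero>\<^bsub>M\<^esub>}" x] that by (simp add: ann_eq_colon zero)
  then show ?thesis
    by (auto simp: torsion_def carrier)
qed

text \<open>
  Fairness stated for carriers in one type applies to every module that injects into that type.
\<close>

lemma fair_wrt_transport:
  fixes f :: "_ \<Rightarrow> 'e"
  assumes "fair_wrt TYPE('e) R \<aa> \<tau>" "inj_on f (carrier M)"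
  shows "rel_assassin R M (torsion R \<tau> M) = rel_assassin R M {\<zero>\<^bsub>M\<^esub>} - Var R \<aa>"
proof -
  have "rel_assassin R (transport f M) (f ` torsion R \<tau> M) =
      rel_assassin R (transport f M) (f ` {\<zero>\<^bsub>M\<^esub>}) - Var R \<aa>"
    using assms(1) module_transport[OF assms(2)]
    by (simp add: fair_wrt_def torsion_transport[OF assms(2), symmetric])
      (simp add: transport_def)
  moreover have "torsion R \<tau> M \<subseteq> carrier M" by (auto simp: torsion_def)
  ultimately show ?thesis
    by (simp add: rel_assassin_transport[OF assms(2)] del: image_insert image_empty)
qed

end

section \<open>Submodules of a localised module\<close>

context localisation begin

text \<open>
  The image of \<open>S\<^sup>-\<^sup>1G\<close> in \<open>S\<^sup>-\<^sup>1M\<close>.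
\<close>

definition loc_sub :: "('a, 'c, 'm) module_scheme \<Rightarrow> 'c set \<Rightarrow> ('c \<times> 'a) set set" where
  "loc_sub M G = {frac R M S y s | y s. y \<in> G \<and> s \<in> T}"

text \<open>
  The ideals \<open>I\<close> and \<open>contraction (ext I)\<close> may differ, but a prime avoiding the denominators contains both
  or neither.
\<close>

lemma min_primes_ext:
  assumes "ideal I R" "primeideal \<pp> R" "\<pp> \<inter> T = {}"
  shows "ext \<pp> \<in> min_primes A (ext I) \<longleftrightarrow> \<pp> \<in> min_primes R I"
proof -
  have "contraction (ext I) \<subseteq> \<qq> \<longleftrightarrow> I \<subseteq> \<qq>" if q: "primeideal \<qq> R" "\<qq> \<subseteq> \<pp>" for \<qq>
  proof -
    have "\<qq> \<inter> T = {}" using q assms(3) by blast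
    note ce = contr_ext_prime[OF q(1) this]
    have id: "ideal (ext \<qq>) A" by (rule ideal_ext[OF primeideal.axioms(1)[OF q(1)]])
    show ?thesis
      using ideal_le_iff[OF ideal_ext[OF assms(1)] id] ext_le_iff[OF assms(1) id] by (simp add: ce)
  qed
  then have "\<pp> \<in> min_primes R (contraction (ext I)) \<longleftrightarrow> \<pp> \<in> min_primes R I"
    unfolding min_primes_def Var_def mem_Collect_eq Ball_def using assms(2) by (metis order_refl)
  then show ?thesis
    using min_primes_contr[OF ideal_ext[OF assms(1)] prime_ext[OF assms(2,3)]]
    by (simp add: contr_ext_prime[OF assms(2,3)])
qed

lemma mem_loc_sub_iff:
  assumes "module R M" "submodule G R M" "x \<in> carrier M" "s \<in> T"
  shows "frac R M S x s \<in> loc_sub M G \<longleftrightarrow> (\<exists>u\<in>T. u \<odot>\<^bsub>M\<^esub> x \<in> G)"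
proof -
  interpret M: module R M by fact
  interpret G: submodule G R M by fact
  have G: "y \<in> carrier M" if "y \<in> G" for y using G.subset that by auto
  show ?thesis
  proof
    assume "frac R M S x s \<in> loc_sub M G"
    then obtain y t where y: "y \<in> G" "t \<in> T" "frac R M S x s = frac R M S y t"
      by (auto simp: loc_sub_def)
    then obtain u where u: "u \<in> T" "(u \<otimes> t) \<odot>\<^bsub>M\<^esub> x = (u \<otimes> s) \<odot>\<^bsub>M\<^esub> y"
      using frac_eq_iff[OF assms(1), of x y s t] assms G by auto
    moreover have "(u \<otimes> s) \<odot>\<^bsub>M\<^esub> y \<in> G" using u(1) y assms(4) by (intro G.smult_closed) simp_all
    ultimately show "\<exists>u\<in>T. u \<odot>\<^bsub>M\<^esub> x \<in> G" using y(2) mult_T by metis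
  next
    assume "\<exists>u\<in>T. u \<odot>\<^bsub>M\<^esub> x \<in> G"
    then obtain u where u: "u \<in> T" "u \<odot>\<^bsub>M\<^esub> x \<in> G" by blast
    have "frac R M S x s = frac R M S (u \<odot>\<^bsub>M\<^esub> x) (u \<otimes> s)"
      using u assms by (intro frac_eqI) (simp_all add: M.smult_assoc1[symmetric] m_comm)
    moreover have "u \<otimes> s \<in> T" using u assms by simp
    ultimately show "frac R M S x s \<in> loc_sub M G"
      unfolding loc_sub_def using u(2) by blast
  qed
qed

lemma colon_loc_sub:
  assumes "module R M" "submodule G R M" "x \<in> carrier M" "s \<in> T"
  shows "colon A (L M) (loc_sub M G) (frac R M S x s) = ext (colon R M G x)"
proof -
  interpret M: module R M by fact
  have id: "ideal (colon R M G x) R" by (rule M.ideal_colon[OF assms(2,3)])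
  have "ring_frac R S r t \<odot>\<^bsub>L M\<^esub> frac R M S x s \<in> loc_sub M G \<longleftrightarrow> ring_frac R S r t \<in> ext (colon R M G x)"
    if "r \<in> carrier R" "t \<in> T" for r t
  proof -
    have "u \<otimes> r \<in> colon R M G x \<longleftrightarrow> u \<odot>\<^bsub>M\<^esub> (r \<odot>\<^bsub>M\<^esub> x) \<in> G" if "u \<in> T" for u
      using that assms(3) \<open>r \<in> carrier R\<close> by (simp add: colon_def M.smult_assoc1)
    then show ?thesis
      using that assms by (simp add: frac_smult mem_loc_sub_iff mem_ext_iff[OF id])
  qed
  moreover have "ext (colon R M G x) \<subseteq> carrier A"
    using ideal.Icarr[OF ideal_ext[OF id]] by blast
  ultimately show ?thesis
    unfolding colon_def[of A] by (blast elim: loc_ringE)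
qed

lemma rel_assassin_loc:
  assumes "module R M" "submodule G R M" "primeideal \<pp> R" "\<pp> \<inter> T = {}"
  shows "ext \<pp> \<in> rel_assassin A (L M) (loc_sub M G) \<longleftrightarrow> \<pp> \<in> rel_assassin R M G"
proof -
  interpret M: module R M by fact
  have iff: "ext \<pp> \<in> min_primes A (colon A (L M) (loc_sub M G) (frac R M S x s)) \<longleftrightarrow> \<pp> \<in> min_primes R (colon R M G x)"
    if "x \<in> carrier M" "s \<in> T" for x s
    using min_primes_ext[OF M.ideal_colon[OF assms(2) that(1)] assms(3,4)] colon_loc_sub[OF assms(1,2) that]
    by simp
  have "(\<exists>X\<in>carrier (L M). ext \<pp> \<in> min_primes A (colon A (L M) (loc_sub M G) X)) \<longleftrightarrow>
      (\<exists>x\<in>carrier M. \<pp> \<in> min_primes R (colon R M G x))"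
  proof
    show "\<exists>X\<in>carrier (L M). ext \<pp> \<in> min_primes A (colon A (L M) (loc_sub M G) X)"
      if "\<exists>x\<in>carrier M. \<pp> \<in> min_primes R (colon R M G x)"
      using that iff[OF _ one_T] frac_closed[of _ M, OF _ one_T] by metis
  qed (auto simp: iff elim!: loc_carrierE)
  then show ?thesis
    using assms(3) prime_ext[OF assms(3,4)] by (simp add: rel_assassin_def)
qed

lemma loc_sub_zero:
  assumes "module R M"
  shows "loc_sub M {\<zero>\<^bsub>M\<^esub>} = {\<zero>\<^bsub>L M\<^esub>}"
proof -
  interpret M: module R M by fact
  have "frac R M S \<zero>\<^bsub>M\<^esub> s = frac R M S \<zero>\<^bsub>M\<^esub> \<one>" if "s \<in> T" for s
    using that by (intro frac_eqI[OF assms]) simp_all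
  then show ?thesis
    using one_T unfolding loc_sub_def loc_zero by blast
qed

lemma loc_incl_image:
  assumes "module R M" "submodule G R M"
  shows "loc_incl R S M ` carrier (L (M\<lparr>carrier := G\<rparr>)) = loc_sub M G"
proof -
  interpret M: module R M by fact
  interpret G: submodule G R M by fact
  have "loc_incl R S M (frac R (M\<lparr>carrier := G\<rparr>) S x s) = frac R M S x s" if "x \<in> G" "s \<in> T" for x s
  proof -
    let ?X = "frac R (M\<lparr>carrier := G\<rparr>) S x s"
    have "(x, s) \<in> ?X"
      using that by (auto simp: frac_def frac_rel_iff intro: one_T)
    then have "?X \<noteq> {}" by blast
    moreover have "frac R M S y t = frac R M S x s" if "(y, t) \<in> ?X" for y t
      using that \<open>x \<in> G\<close> G.subset unfolding frac_def
      by (intro equiv_class_eq[OF equiv_frac_rel[OF assms(1)], symmetric])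
        (auto simp: frac_rel_iff)
    ultimately show ?thesis
      unfolding loc_incl_def by - (rule SUP_eq_const, simp_all only: split_paired_all prod.case not_False_eq_True)
  qed
  moreover have "carrier (L (M\<lparr>carrier := G\<rparr>)) = {frac R (M\<lparr>carrier := G\<rparr>) S x s | x s. x \<in> G \<and> s \<in> T}"
    by (auto simp: loc_module_def frac_def quotient_def)
  ultimately show ?thesis
    unfolding loc_sub_def by (auto simp only: image_iff mem_Collect_eq) metis
qed

text \<open>
  The image of \<open>S\<^sup>-\<^sup>1\<Gamma>(M)\<close> in \<open>S\<^sup>-\<^sup>1M\<close> is always torsion; that \<open>\<rho>\<close> is onto says that it is all of the
  torsion. The same holds for \<open>\<rho>\<close> with a bar in the lemma after this one.
\<close>

lemma torsion_loc_small:
  fixes M :: "('a, 'c) module"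
  assumes "rho_iso TYPE('c) R S \<aa>" "module R M" "ideal \<aa> R"
  shows "torsion A (small_filter A (ext \<aa>)) (L M) = loc_sub M (torsion R (small_filter R \<aa>) M)"
proof -
  interpret M: module R M by fact
  have "bij_betw (loc_incl R S M) (carrier (L (M\<lparr>carrier := small_torsion R \<aa> M\<rparr>)))
      (small_torsion A (ext \<aa>) (L M))"
    using assms(1,2) by (auto simp: rho_iso_def module_iso_def iso_def)
  then show ?thesis
    using loc_incl_image[OF assms(2) M.submodule_torsion[OF ideal_filter_small[OF assms(3)]]]
    by (simp add: bij_betw_def small_torsion_eq)
qed

lemma torsion_loc_large:
  fixes M :: "('a, 'c) module"
  assumes "rho_bar_iso TYPE('c) R S \<aa>" "module R M" "ideal \<aa> R"
  shows "torsion A (large_filter A (ext \<aa>)) (L M) = loc_sub M (torsion R (large_filter R \<aa>) M)"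
proof -
  interpret M: module R M by fact
  interpret a: ideal \<aa> R by fact
  have "bij_betw (loc_incl R S M) (carrier (L (M\<lparr>carrier := large_torsion R \<aa> M\<rparr>)))
      (large_torsion A (ext \<aa>) (L M))"
    using assms(1,2) by (auto simp: rho_bar_iso_def module_iso_def iso_def)
  then show ?thesis
    using loc_incl_image[OF assms(2) M.submodule_torsion[OF ideal_filter_large[OF a.a_subset]]]
    by (simp add: bij_betw_def large_torsion_eq)
qed

text \<open>
  If \<open>M = R x\<close>, then \<open>y/s\<close> depends on \<open>s\<close> only through \<open>s x\<close>: if \<open>s x = t x\<close>, then \<open>s y = t y\<close> for all
  \<open>y \<in> R x\<close>. Hence \<open>S\<^sup>-\<^sup>1M\<close> is an image of \<open>M \<times> M\<close>, which is no larger than \<open>M\<close> when \<open>M\<close> is infinite.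
  When \<open>M\<close> is finite, the powers of \<open>s\<close> repeat on \<open>y\<close>, so \<open>s\<close> can be inverted within \<open>M\<close>, and
  \<open>M \<rightarrow> S\<^sup>-\<^sup>1M\<close> is onto.
\<close>

lemma cyclic_loc_inj:
  includes cardinal_syntax
  fixes M :: "('a, 'c, 'm) module_scheme"
  assumes "module R M" "x \<in> carrier M" and cyc: "\<And>y. y \<in> carrier M \<Longrightarrow> \<exists>r\<in>carrier R. y = r \<odot>\<^bsub>M\<^esub> x"
  shows "\<exists>f :: _ \<Rightarrow> 'c. inj_on f (carrier (L M))"
proof -
  interpret M: module R M by fact
  have "|carrier (L M)| \<le>o |carrier M|"
  proof (cases "finite (carrier M)")
    case True
    have "carrier (L M) \<subseteq> (\<lambda>y. frac R M S y \<one>) ` carrier M"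
    proof
      fix X assume "X \<in> carrier (L M)"
      then obtain y s where y: "y \<in> carrier M" "s \<in> T" "X = frac R M S y s"
        by (rule loc_carrierE)
      have pc: "s [^] n \<in> carrier R" for n :: nat using y(2) by simp
      let ?g = "\<lambda>n::nat. s [^] n \<odot>\<^bsub>M\<^esub> y"
      have "range ?g \<subseteq> carrier M" using y pc by auto
      then have "\<not> inj ?g"
        using True by (meson finite_subset finite_imageD infinite_UNIV_nat)
      then obtain i j where "i < j" "?g i = ?g j"
        unfolding inj_on_def by (metis linorder_neqE_nat)
      then obtain k where k: "?g i = ?g (i + Suc k)"
        by (metis less_iff_Suc_add add_Suc_right)
      \<comment> \<open>Cancelling \<open>s\<^sup>i\<close> in \<open>s\<^sup>i y = s\<^sup>i\<^sup>+\<^sup>k\<^sup>+\<^sup>1 y\<close> gives \<open>y = s (s\<^sup>k y)\<close> in the localisation.\<close>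
      have "(s [^] i \<otimes> \<one>) \<odot>\<^bsub>M\<^esub> y = (s [^] i \<otimes> s) \<odot>\<^bsub>M\<^esub> (s [^] k \<odot>\<^bsub>M\<^esub> y)"
      proof -
        have "s [^] i \<otimes> s \<otimes> s [^] k = s [^] (i + Suc k)"
          using pc y(2) by (simp add: nat_pow_mult[symmetric] m_ac)
        then show ?thesis
          using k pc y by (simp add: M.smult_assoc1[symmetric] del: nat_pow_Suc add_Suc_right)
      qed
      then have "X = frac R M S (s [^] k \<odot>\<^bsub>M\<^esub> y) \<one>"
        unfolding y(3) using y pc pow_T[OF y(2), of i] by (subst frac_eq_iff[OF assms(1)]) auto
      then show "X \<in> (\<lambda>y. frac R M S y \<one>) ` carrier M" using y pc by blast
    qed
    then show ?thesis by (rule surj_imp_ordLeq)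
  next
    case False
    let ?g = "\<lambda>(y, z). frac R M S y (SOME s. s \<in> T \<and> s \<odot>\<^bsub>M\<^esub> x = z)"
    have "carrier (L M) \<subseteq> ?g ` (carrier M \<times> carrier M)"
    proof
      fix X assume "X \<in> carrier (L M)"
      then obtain y s where y: "y \<in> carrier M" "s \<in> T" "X = frac R M S y s"
        by (rule loc_carrierE)
      define t where "t = (SOME t. t \<in> T \<and> t \<odot>\<^bsub>M\<^esub> x = s \<odot>\<^bsub>M\<^esub> x)"
      have t: "t \<in> T" "t \<odot>\<^bsub>M\<^esub> x = s \<odot>\<^bsub>M\<^esub> x"
        unfolding atomize_conj t_def by (rule someI[of _ s]) (use y in simp)
      obtain r where r: "r \<in> carrier R" "y = r \<odot>\<^bsub>M\<^esub> x" using cyc y(1) by blast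
      have comm: "u \<odot>\<^bsub>M\<^esub> y = r \<odot>\<^bsub>M\<^esub> (u \<odot>\<^bsub>M\<^esub> x)" if "u \<in> T" for u
        using that r assms(2) by (simp add: M.smult_assoc1[symmetric] m_comm)
      have "X = frac R M S y t"
        unfolding y(3) by (rule frac_eqI[OF assms(1)]) (use y t comm in simp_all)
      then have "X = ?g (y, s \<odot>\<^bsub>M\<^esub> x)" by (simp add: t_def)
      then show "X \<in> ?g ` (carrier M \<times> carrier M)"
        by (rule image_eqI) (use y assms(2) in simp)
    qed
    then have "|carrier (L M)| \<le>o |carrier M \<times> carrier M|" by (rule surj_imp_ordLeq)
    then show ?thesis
      using card_of_Times_same_infinite[OF False] ordLeq_ordIso_trans by blast
  qed
  then show ?thesis
    unfolding card_of_ordLeq[symmetric] by blast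
qed

end

section \<open>Maximal ideals and cyclic modules\<close>

lemma (in cring) exists_maximalideal:
  assumes "ideal I R" "I \<noteq> carrier R"
  obtains \<mm> where "maximalideal \<mm> R" "I \<subseteq> \<mm>"
proof -
  let ?F = "{J. ideal J R \<and> I \<subseteq> J \<and> \<one> \<notin> J}"
  have 1: "\<one> \<notin> I" using assms ideal.one_imp_carrier by blast
  have "\<exists>\<mm>\<in>?F. \<forall>X\<in>?F. \<mm> \<subseteq> X \<longrightarrow> X = \<mm>"
  proof (rule subset_Zorn_nonempty)
    show "?F \<noteq> {}" using assms(1) 1 by blast
    fix C assume C: "C \<noteq> {}" "subset.chain ?F C"
    have id: "ideal X R" if "X \<in> C" for X
      using C(2) that by (auto simp: subset.chain_def)
    have ch: "X \<subseteq> Y \<or> Y \<subseteq> X" if "X \<in> C" "Y \<in> C" for X Y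
      using C(2) that by (auto simp: subset.chain_def)
    have sub: "additive_subgroup X R" if "X \<in> C" for X
      using id[OF that] by (rule ideal.axioms)
    have "ideal (\<Union>C) R"
    proof (rule idealI[OF ring_axioms])
      show "subgroup (\<Union>C) (add_monoid R)"
      proof (rule add.subgroupI)
        show "\<Union>C \<subseteq> carrier R" using sub additive_subgroup.a_subset by blast
        show "\<Union>C \<noteq> {}" using C(1) sub additive_subgroup.zero_closed by blast
        show "\<ominus> a \<in> \<Union>C" if "a \<in> \<Union>C" for a
        proof -
          obtain X where "X \<in> C" "a \<in> X" using \<open>a \<in> _\<close> by blast
          then show ?thesis using additive_subgroup.a_inv_closed[OF sub] by blast
        qed
        show "a \<oplus> b \<in> \<Union>C" if ab: "a \<in> \<Union>C" "b \<in> \<Union>C" for a b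
        proof -
          obtain X Y where "X \<in> C" "Y \<in> C" "a \<in> X" "b \<in> Y" using ab by blast
          then obtain Z where "Z \<in> C" "a \<in> Z" "b \<in> Z" using ch by blast
          then show ?thesis using additive_subgroup.a_closed[OF sub] by blast
        qed
      qed
      show "x \<otimes> a \<in> \<Union>C" "a \<otimes> x \<in> \<Union>C" if "a \<in> \<Union>C" "x \<in> carrier R" for a x
        using that id ideal.I_l_closed ideal.I_r_closed by (metis UnionE UnionI)+
    qed
    then show "\<Union>C \<in> ?F"
      using C by (auto simp: subset.chain_def)
  qed
  then obtain \<mm> where m: "\<mm> \<in> ?F" and max: "\<forall>X\<in>?F. \<mm> \<subseteq> X \<longrightarrow> X = \<mm>" ..
  have "maximalideal \<mm> R"
  proof (rule maximalidealI)
    show "ideal \<mm> R" using m by blast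
    show "carrier R \<noteq> \<mm>" using m one_closed by blast
    show "J = \<mm> \<or> J = carrier R" if "ideal J R" "\<mm> \<subseteq> J" for J
    proof (cases "\<one> \<in> J")
      case True
      then show ?thesis using ideal.one_imp_carrier[OF that(1)] by simp
    next
      case False
      then have "J \<in> ?F" using m that by auto
      then show ?thesis using max that(2) by simp
    qed
  qed
  then show ?thesis using that m by blast
qed

lemma localisation_prime_complement:
  assumes "primeideal \<pp> R"
  shows "localisation R (carrier R - \<pp>)" and "mult_closure R (carrier R - \<pp>) = carrier R - \<pp>"
proof -
  interpret p: primeideal \<pp> R by fact
  show "localisation R (carrier R - \<pp>)"
    by (intro localisation.intro localisation_axioms.intro p.is_cring) blast
  have "submonoid (carrier R - \<pp>) R"
    using p.I_prime p.one_imp_carrier p.I_notcarr by (intro submonoid.intro) auto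
  then show "mult_closure R (carrier R - \<pp>) = carrier R - \<pp>"
    unfolding mult_closure_def by (rule hull_same)
qed

context module begin

abbreviation cyclic_sub where "cyclic_sub x \<equiv> (\<lambda>r. r \<odot>\<^bsub>M\<^esub> x) ` carrier R"

lemma submodule_cyclic:
  assumes "x \<in> carrier M"
  shows "submodule (cyclic_sub x) R M"
proof (rule submoduleI)
  show "\<zero>\<^bsub>M\<^esub> \<in> cyclic_sub x"
    using assms by (intro image_eqI[of _ _ \<zero>]) simp_all
  show "\<ominus>\<^bsub>M\<^esub> y \<in> cyclic_sub x" if "y \<in> cyclic_sub x" for y
    using that assms by (auto simp: smult_l_minus[symmetric])
  show "y \<oplus>\<^bsub>M\<^esub> z \<in> cyclic_sub x" if "y \<in> cyclic_sub x" "z \<in> cyclic_sub x" for y z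
    using that assms by (auto simp: smult_l_distr[symmetric])
  show "a \<odot>\<^bsub>M\<^esub> y \<in> cyclic_sub x" if "a \<in> carrier R" "y \<in> cyclic_sub x" for a y
    using that assms by (auto simp: smult_assoc1[symmetric])
qed (use assms in auto)

lemma torsion_sub:
  assumes "N \<subseteq> carrier M"
  shows "torsion R \<tau> (M\<lparr>carrier := N\<rparr>) = torsion R \<tau> M \<inter> N"
  using assms by (auto simp: torsion_def ann_def)

lemma colon_sub:
  assumes "submodule N R M" "y \<in> N"
  shows "colon R (M\<lparr>carrier := N\<rparr>) (G \<inter> N) y = colon R M G y"
  using submodule.smult_closed[OF assms(1) _ assms(2)] by (auto simp: colon_def)

text \<open>
  A prime is weakly associated through a single element \<open>x\<close>, and \<open>(G : y)\<close> for \<open>y \<in> R x\<close> can be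
  computed inside \<open>R x\<close>.
\<close>

lemma rel_assassin_eq_cyclic:
  "rel_assassin R M G = (\<Union>x\<in>carrier M. rel_assassin R (M\<lparr>carrier := cyclic_sub x\<rparr>) (G \<inter> cyclic_sub x))"
proof -
  have "\<pp> \<in> rel_assassin R M G" if x: "x \<in> carrier M"
    and p: "\<pp> \<in> rel_assassin R (M\<lparr>carrier := cyclic_sub x\<rparr>) (G \<inter> cyclic_sub x)" for x \<pp>
  proof -
    obtain y where "primeideal \<pp> R" "y \<in> cyclic_sub x" "\<pp> \<in> min_primes R (colon R M G y)"
      using p colon_sub[OF submodule_cyclic[OF x], of _ G]
      by (auto simp: rel_assassin_def)
    moreover from this(2) have "y \<in> carrier M" using x by auto
    ultimately show ?thesis by (auto simp: rel_assassin_def)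
  qed
  moreover have "\<exists>x\<in>carrier M. \<pp> \<in> rel_assassin R (M\<lparr>carrier := cyclic_sub x\<rparr>) (G \<inter> cyclic_sub x)"
    if p: "\<pp> \<in> rel_assassin R M G" for \<pp>
  proof -
    obtain x where x: "primeideal \<pp> R" "x \<in> carrier M" "\<pp> \<in> min_primes R (colon R M G x)"
      using p by (auto simp: rel_assassin_def)
    have "x \<in> cyclic_sub x" using x(2) by (intro image_eqI[of _ _ \<one>]) simp_all
    moreover from this have "\<pp> \<in> min_primes R (colon R (M\<lparr>carrier := cyclic_sub x\<rparr>) (G \<inter> cyclic_sub x) x)"
      using x(3) colon_sub[OF submodule_cyclic[OF x(2)], of x G] by simp
    ultimately have "\<pp> \<in> rel_assassin R (M\<lparr>carrier := cyclic_sub x\<rparr>) (G \<inter> cyclic_sub x)"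
      unfolding rel_assassin_def mem_Collect_eq by (intro conjI x(1) bexI[of _ x]) simp_all
    then show ?thesis using x(2) by blast
  qed
  ultimately show ?thesis by blast
qed

end

text \<open>
  The identity is checked one prime at a time, on cyclic modules, after localising at a maximal ideal
  containing that prime; both sides of the identity, including the condition \<open>\<aa> \<subseteq> \<pp>\<close>, survive the
  localisation because \<open>\<pp>\<close> avoids its denominators.
\<close>

theorem (in cring) fair_wrt_from_maximal:
  assumes a: "ideal \<aa> R" and filter: "ideal_filter R \<tau>"
    and local: "\<And>\<mm>. maximalideal \<mm> R \<Longrightarrow>
      fair_wrt TYPE('c) (loc_ring R (carrier R - \<mm>)) (loc_ideal R (carrier R - \<mm>) \<aa>) (\<tau>' \<mm>)"
    and torsion: "\<And>\<mm> M :: ('a, 'c) module. maximalideal \<mm> R \<Longrightarrow> module R M \<Longrightarrow>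
      torsion (loc_ring R (carrier R - \<mm>)) (\<tau>' \<mm>) (loc_module R (carrier R - \<mm>) M) =
        localisation.loc_sub R (carrier R - \<mm>) M (torsion R \<tau> M)"
  shows "fair_wrt TYPE('c) R \<aa> \<tau>"
proof -
  have cyc: "rel_assassin R C (torsion R \<tau> C) = rel_assassin R C {\<zero>\<^bsub>C\<^esub>} - Var R \<aa>"
    if C: "module R C" and x: "x \<in> carrier C" and gen: "\<And>y. y \<in> carrier C \<Longrightarrow> \<exists>r\<in>carrier R. y = r \<odot>\<^bsub>C\<^esub> x"
    for C :: "('a, 'c) module" and x
  proof -
    interpret C: module R C by fact
    have "\<pp> \<in> rel_assassin R C (torsion R \<tau> C) \<longleftrightarrow> \<pp> \<in> rel_assassin R C {\<zero>\<^bsub>C\<^esub>} - Var R \<aa>"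
      if p: "primeideal \<pp> R" for \<pp>
    proof -
      interpret p: primeideal \<pp> R by fact
      obtain \<mm> where m: "maximalideal \<mm> R" "\<pp> \<subseteq> \<mm>"
        using exists_maximalideal[OF p.ideal_axioms] p.I_notcarr by metis
      note m' = localisation_prime_complement[OF maximalideal_prime[OF m(1)]]
      interpret localisation R "carrier R - \<mm>" by (rule m'(1))
      have disj: "\<pp> \<inter> T = {}" using m m' by auto
      obtain f :: "_ \<Rightarrow> 'c" where f: "inj_on f (carrier (L C))"
        using cyclic_loc_inj[OF C x gen] by blast
      interpret LC: module A "L C" by (rule module_loc[OF C])
      have "rel_assassin A (L C) (torsion A (\<tau>' \<mm>) (L C)) =
          rel_assassin A (L C) {\<zero>\<^bsub>L C\<^esub>} - Var A (ext \<aa>)"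
        by (rule LC.fair_wrt_transport[OF local[OF m(1)] f])
      then have "rel_assassin A (L C) (loc_sub C (torsion R \<tau> C)) =
          rel_assassin A (L C) (loc_sub C {\<zero>\<^bsub>C\<^esub>}) - Var A (ext \<aa>)"
        by (simp only: torsion[OF m(1) C] loc_sub_zero[OF C])
      moreover have "ext \<pp> \<in> Var A (ext \<aa>) \<longleftrightarrow> \<pp> \<in> Var R \<aa>"
        using p prime_ext[OF p disj] ext_le_iff[OF a ideal_ext[OF p.ideal_axioms]]
        by (simp add: Var_def contr_ext_prime[OF p disj])
      ultimately show ?thesis
        using rel_assassin_loc[OF C _ p disj] C.submodule_torsion[OF filter] C.submodule_zero
        by (metis Diff_iff)
    qed
    then show ?thesis by (auto simp: rel_assassin_def)
  qed
  show ?thesis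
    unfolding fair_wrt_def
  proof (intro allI impI)
    fix M :: "('a, 'c) module"
    assume M: "module R M"
    interpret M: module R M by fact
    let ?N = "\<lambda>x. M\<lparr>carrier := M.cyclic_sub x\<rparr>"
    have "rel_assassin R (?N x) (torsion R \<tau> M \<inter> M.cyclic_sub x) =
        rel_assassin R (?N x) ({\<zero>\<^bsub>M\<^esub>} \<inter> M.cyclic_sub x) - Var R \<aa>" if x: "x \<in> carrier M" for x
    proof -
      interpret s: submodule "M.cyclic_sub x" R M by (rule M.submodule_cyclic[OF x])
      have "x \<in> M.cyclic_sub x" using x by (intro image_eqI[of _ _ \<one>]) simp_all
      then have "rel_assassin R (?N x) (torsion R \<tau> (?N x)) = rel_assassin R (?N x) {\<zero>\<^bsub>?N x\<^esub>} - Var R \<aa>"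
        by (intro cyc[OF s.submodule_is_module[OF M], of x]) auto
      moreover have "{\<zero>\<^bsub>M\<^esub>} \<inter> M.cyclic_sub x = {\<zero>\<^bsub>M\<^esub>}"
        using s.one_closed by auto
      ultimately show ?thesis
        using M.torsion_sub[OF s.subset[simplified]] by simp
    qed
    then show "rel_assassin R M (torsion R \<tau> M) = rel_assassin R M {\<zero>\<^bsub>M\<^esub>} - Var R \<aa>"
      unfolding M.rel_assassin_eq_cyclic[of "torsion R \<tau> M"] M.rel_assassin_eq_cyclic[of "{\<zero>\<^bsub>M\<^esub>}"]
      by blast
  qed
qed

section \<open>Weak fairness and localisation\<close>

theorem mainTheorem11:
  fixes R :: "('a, 'r) ring_scheme" and \<aa> :: "'a set"
  assumes "cring R" and "ideal \<aa> R"
  shows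
    "(\<forall>S. S \<subseteq> carrier R \<longrightarrow>
        (rho_iso TYPE('b) R S \<aa> \<and> weakly_fair TYPE('b) R \<aa>
           \<longrightarrow> weakly_fair TYPE('b) (loc_ring R S) (loc_ideal R S \<aa>)) \<and>
        (rho_bar_iso TYPE('b) R S \<aa> \<and> weakly_large_fair TYPE('b) R \<aa>
           \<longrightarrow> weakly_large_fair TYPE('b) (loc_ring R S) (loc_ideal R S \<aa>))) \<and>
     ((\<forall>\<mm>. maximalideal \<mm> R \<longrightarrow> rho_iso TYPE('b) R (carrier R - \<mm>) \<aa>) \<longrightarrow>
        (weakly_fair TYPE('b) R \<aa> \<longleftrightarrow>
           (\<forall>\<mm>. maximalideal \<mm> R \<longrightarrow>
              weakly_fair TYPE('b) (loc_ring R (carrier R - \<mm>)) (loc_ideal R (carrier R - \<mm>) \<aa>)))) \<and>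
     ((\<forall>\<mm>. maximalideal \<mm> R \<longrightarrow> rho_bar_iso TYPE('b) R (carrier R - \<mm>) \<aa>) \<longrightarrow>
        (weakly_large_fair TYPE('b) R \<aa> \<longleftrightarrow>
           (\<forall>\<mm>. maximalideal \<mm> R \<longrightarrow>
              weakly_large_fair TYPE('b) (loc_ring R (carrier R - \<mm>)) (loc_ideal R (carrier R - \<mm>) \<aa>))))"
proof -
  interpret cring R by fact
  interpret a: ideal \<aa> R by fact
  note filters = ideal_filter_small[OF assms(2)] ideal_filter_large[OF a.a_subset]
  have fair_iff: "weakly_fair TYPE('b) R \<aa> \<longleftrightarrow> fair_wrt TYPE('b) R \<aa> (small_filter R \<aa>)"
    "weakly_large_fair TYPE('b) R \<aa> \<longleftrightarrow> fair_wrt TYPE('b) R \<aa> (large_filter R \<aa>)"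
    using ring_axioms assms(2) by (rule weakly_fair_iff weakly_large_fair_iff)+
  have loc: "localisation R S" if "S \<subseteq> carrier R" for S
    by (intro localisation.intro localisation_axioms.intro cring_axioms that)
  have loc_fair_iff:
    "weakly_fair TYPE('b) (loc_ring R S) (loc_ideal R S \<aa>) \<longleftrightarrow>
      fair_wrt TYPE('b) (loc_ring R S) (loc_ideal R S \<aa>) (small_filter (loc_ring R S) (loc_ideal R S \<aa>))"
    "weakly_large_fair TYPE('b) (loc_ring R S) (loc_ideal R S \<aa>) \<longleftrightarrow>
      fair_wrt TYPE('b) (loc_ring R S) (loc_ideal R S \<aa>) (large_filter (loc_ring R S) (loc_ideal R S \<aa>))"
    if "S \<subseteq> carrier R" for S
  proof -
    interpret localisation R S by (rule loc[OF that])
    have "ring A" using cring_loc by (rule cring.axioms)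
    note * = this ideal_ext[OF assms(2)]
    show "weakly_fair TYPE('b) A (ext \<aa>) \<longleftrightarrow> fair_wrt TYPE('b) A (ext \<aa>) (small_filter A (ext \<aa>))"
      "weakly_large_fair TYPE('b) A (ext \<aa>) \<longleftrightarrow> fair_wrt TYPE('b) A (ext \<aa>) (large_filter A (ext \<aa>))"
      by (rule weakly_fair_iff[OF *] weakly_large_fair_iff[OF *])+
  qed
  have descent:
    "weakly_fair TYPE('b) R \<aa> \<Longrightarrow> weakly_fair TYPE('b) (loc_ring R S) (loc_ideal R S \<aa>)"
    "weakly_large_fair TYPE('b) R \<aa> \<Longrightarrow> weakly_large_fair TYPE('b) (loc_ring R S) (loc_ideal R S \<aa>)"
    if S: "S \<subseteq> carrier R" for S
  proof -
    interpret localisation R S by (rule loc[OF S])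
    interpret A: cring A by (rule cring_loc)
    interpret e: ideal "ext \<aa>" A by (rule ideal_ext[OF assms(2)])
    show "weakly_fair TYPE('b) A (ext \<aa>)" if "weakly_fair TYPE('b) R \<aa>"
      unfolding loc_fair_iff[OF S]
      by (rule fair_wrt_localisation[OF assms(2) A.ideal_filter_small[OF e.ideal_axioms] _ that[unfolded fair_iff]])
        (rule small_filter_ext[OF assms(2)])
    show "weakly_large_fair TYPE('b) A (ext \<aa>)" if "weakly_large_fair TYPE('b) R \<aa>"
      unfolding loc_fair_iff[OF S]
      by (rule fair_wrt_localisation[OF assms(2) A.ideal_filter_large[OF e.a_subset] _ that[unfolded fair_iff]])
        (rule large_filter_ext[OF assms(2)])
  qed
  have ascent_small: "weakly_fair TYPE('b) R \<aa>"
    if rho: "\<And>\<mm>. maximalideal \<mm> R \<Longrightarrow> rho_iso TYPE('b) R (carrier R - \<mm>) \<aa>"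
      and fair: "\<And>\<mm>. maximalideal \<mm> R \<Longrightarrow>
        weakly_fair TYPE('b) (loc_ring R (carrier R - \<mm>)) (loc_ideal R (carrier R - \<mm>) \<aa>)"
    unfolding fair_iff
  proof (rule fair_wrt_from_maximal[OF assms(2) filters(1)])
    fix \<mm> assume m: "maximalideal \<mm> R"
    interpret localisation R "carrier R - \<mm>" by (rule loc) blast
    show "fair_wrt TYPE('b) A (ext \<aa>) (small_filter A (ext \<aa>))"
      using fair[OF m] loc_fair_iff(1)[of "carrier R - \<mm>"] by blast
    show "torsion A (small_filter A (ext \<aa>)) (L M) = loc_sub M (torsion R (small_filter R \<aa>) M)"
      if "module R M" for M :: "('a, 'b) module"
      by (rule torsion_loc_small[OF rho[OF m] that assms(2)])
  qed
  have ascent_large: "weakly_large_fair TYPE('b) R \<aa>"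
    if rho: "\<And>\<mm>. maximalideal \<mm> R \<Longrightarrow> rho_bar_iso TYPE('b) R (carrier R - \<mm>) \<aa>"
      and fair: "\<And>\<mm>. maximalideal \<mm> R \<Longrightarrow>
        weakly_large_fair TYPE('b) (loc_ring R (carrier R - \<mm>)) (loc_ideal R (carrier R - \<mm>) \<aa>)"
    unfolding fair_iff
  proof (rule fair_wrt_from_maximal[OF assms(2) filters(2)])
    fix \<mm> assume m: "maximalideal \<mm> R"
    interpret localisation R "carrier R - \<mm>" by (rule loc) blast
    show "fair_wrt TYPE('b) A (ext \<aa>) (large_filter A (ext \<aa>))"
      using fair[OF m] loc_fair_iff(2)[of "carrier R - \<mm>"] by blast
    show "torsion A (large_filter A (ext \<aa>)) (L M) = loc_sub M (torsion R (large_filter R \<aa>) M)"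
      if "module R M" for M :: "('a, 'b) module"
      by (rule torsion_loc_large[OF rho[OF m] that assms(2)])
  qed
  show ?thesis
    by (intro conjI allI impI iffI)
      (use descent ascent_small ascent_large Diff_subset in blast)+
qed

end
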